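(* Let $n$ be a real number with $2<n<4$ and let $\theta_1\in(0,\infty)$. If $$\lambda\in\left(\frac{n(n-2)}{4},\ \frac{n(n-2)}{4}+L^*\right],$$ then the boundary value problem $$-u''(\theta)-(n-1)\coth\theta\,u'(\theta)=\lambda u(\theta)+u(\theta)^{\frac{n+2}{n-2}},\qquad \theta\in[0,\theta_1],$$ with $u\in H_0^1(\Omega)$ and $u'(0)=u(\theta_1)=0$, has no positive solution.
   Context: Here $n$ is a real parameter and $\alpha=(2-n)/2\in(-1,0)$. Associated Legendre functions. For $\nu\in(-1,1)$, $\theta>0$ and $\ell\in\mathbb{C}$ with $\ell(\ell+1)\in\mathbb{R}$, $$P_\ell^{\nu}(\cosh\theta)=\frac{1}{\Gamma(1-\nu)}\coth^{\nu}\left(\frac{\theta}{2}\right)\,{}_2F_1\left[-\ell,\ell+1,1-\nu;-\sinh^2\left(\frac{\theta}{2}\right)\right],$$ where ${}_2F_1[a,b,c;z]=\sum_{k\ge0}\frac{(a)_k(b)_k}{(c)_k}\frac{z^k}{k!}$ for $|z|<1$, with $(\beta)_k=\prod_{j=0}^{k-1}(\beta+j)$, continued analytically to $z\in(-\infty,0]$. This function depends on $\ell$ only through $\ell(\ell+1)$ and solves $y''+\coth\theta\,y'+\left(-\ell(\ell+1)-\frac{\nu^2}{\sinh^2\theta}\right)y=0$. Write $L=-\ell(\ell+1)$. $L^*$ (depending on $n$ and $\theta_1$) is the smallest positive value of $L$ such that $P_\ell^{-\alpha}(\cosh\theta)>0$ for $0<\theta<\theta_1$ and $P_\ell^{-\alpha}(\cosh\theta_1)=0$.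 For integer $n$, $\Omega$ is the geodesic ball of radius $\theta_1$ in hyperbolic space $\mathbb{H}^n$ and $u$ is a radial function of the geodesic distance $\theta$ to the center. For real $n$, $u\in H_0^1(\Omega)$ means $\int_0^{\theta_1}(u'^2+u^2)\sinh^{n-1}\theta\,d\theta<\infty$ and $u(\theta_1)=0$. A positive solution is a function $u\in C^1([0,\theta_1])\cap C^2((0,\theta_1))$ satisfying the equation on $(0,\theta_1)$ and the boundary conditions, with $u>0$ on $[0,\theta_1)$. *)

theory Defs
  imports "HOL-Complex_Analysis.Complex_Analysis"
begin

text \<open>
  Gauss hypergeometric function. The value at \<open>z\<close> is that of the analytic continuation of the
  series along the straight segment from \<open>0\<close> to \<open>z\<close>; since \<open>S\<close> is required to be convex, this
  value does not depend on the choice of \<open>S\<close> and \<open>f\<close>, see \<open>hyp2F1_eqI\<close>. On the plane slit along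
  \<open>[1, \<infinity>)\<close>, and in particular on \<open>(-\<infinity>, 0]\<close>, it is the principal branch.
\<close>

definition hyp2F1 :: "complex \<Rightarrow> complex \<Rightarrow> complex \<Rightarrow> complex \<Rightarrow> complex" where
  "hyp2F1 a b c z =
     (THE w. \<exists>S f. open S \<and> convex S \<and> 0 \<in> S \<and> z \<in> S \<and> f holomorphic_on S \<and>
        (\<forall>x \<in> S \<inter> ball 0 1. f x = eval_fps (fps_hypergeo [a, b] [c] 1) x) \<and> w = f z)"

lemma eval_fps_hypergeo_2_1:
  "eval_fps (fps_hypergeo [a, b] [c] 1) (z :: complex) =
     (\<Sum>k. pochhammer a k * pochhammer b k / pochhammer c k * z ^ k / fact k)"
  by (simp add: eval_fps_def mult_ac divide_simps)

lemma hyp2F1_eqI: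
  assumes "open S" "convex S" "0 \<in> S" "z \<in> S" "f holomorphic_on S"
    and "\<And>x. x \<in> S \<Longrightarrow> norm x < 1 \<Longrightarrow> f x = eval_fps (fps_hypergeo [a, b] [c] 1) x"
  shows "hyp2F1 a b c z = f z"
  unfolding hyp2F1_def
proof (rule the_equality)
  show "\<exists>S g. open S \<and> convex S \<and> 0 \<in> S \<and> z \<in> S \<and> g holomorphic_on S \<and>
        (\<forall>x \<in> S \<inter> ball 0 1. g x = eval_fps (fps_hypergeo [a, b] [c] 1) x) \<and> f z = g z"
    by (rule exI[of _ S], rule exI[of _ f]) (use assms in auto)
next
  fix w
  assume "\<exists>S g. open S \<and> convex S \<and> 0 \<in> S \<and> z \<in> S \<and> g holomorphic_on S \<and>
        (\<forall>x \<in> S \<inter> ball 0 1. g x = eval_fps (fps_hypergeo [a, b] [c] 1) x) \<and> w = g z"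
  then obtain T g where T: "open T" "convex T" "0 \<in> T" "z \<in> T" "g holomorphic_on T"
      "\<And>x. x \<in> T \<inter> ball 0 1 \<Longrightarrow> g x = eval_fps (fps_hypergeo [a, b] [c] 1) x" and w: "w = g z"
    by blast
  have "g z = f z"
  proof (rule analytic_continuation_open[of "S \<inter> T \<inter> ball 0 1" "S \<inter> T" g f z])
    show "S \<inter> T \<inter> ball 0 1 \<noteq> {}"
      using assms T by force
    show "connected (S \<inter> T)"
      using assms T by (intro convex_connected convex_Int)
  qed (use assms T in \<open>auto intro: holomorphic_on_subset\<close>)
  then show "w = f z" using w by simp
qed

text \<open>
  \<open>legendreP \<nu> l \<theta>\<close> is the associated Legendre function \<open>P\<close> of order \<open>\<nu>\<close> and degree \<open>l\<close>, evaluated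
  at \<open>cosh \<theta>\<close>. It is complex-valued because \<open>l\<close> may be complex; its values are real whenever
  \<open>l (l + 1)\<close> is real and \<open>\<theta> > 0\<close>.
\<close>

definition legendreP :: "real \<Rightarrow> complex \<Rightarrow> real \<Rightarrow> complex" where
  "legendreP \<nu> l \<theta> =
     of_real (1 / Gamma (1 - \<nu>) * (cosh (\<theta>/2) / sinh (\<theta>/2)) powr \<nu>) *
     hyp2F1 (- l) (l + 1) (of_real (1 - \<nu>)) (of_real (- (sinh (\<theta>/2))\<^sup>2))"

text \<open>
  Since \<open>legendreP\<close> depends on \<open>l\<close> only through \<open>l (l + 1)\<close>, the choice of \<open>l\<close> below is immaterial.
\<close>

definition Lstar :: "real \<Rightarrow> real \<Rightarrow> real" where
  "Lstar n \<theta>\<^sub>1 =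
     (let \<alpha> = (2 - n) / 2 in
      LEAST L. L > 0 \<and>
        (\<exists>l::complex. of_real L = - (l * (l + 1)) \<and>
             (\<forall>\<theta>. 0 < \<theta> \<and> \<theta> < \<theta>\<^sub>1 \<longrightarrow> Re (legendreP (- \<alpha>) l \<theta>) > 0) \<and>
             legendreP (- \<alpha>) l \<theta>\<^sub>1 = 0))"

text \<open>
  Radial \<open>H\<^sub>0\<^sup>1\<close> condition on the geodesic ball of radius \<open>\<theta>\<^sub>1\<close> in dimension \<open>n\<close>, for a function \<open>u\<close>
  with derivative \<open>u'\<close>.
\<close>

definition radial_H10 :: "real \<Rightarrow> real \<Rightarrow> (real \<Rightarrow> real) \<Rightarrow> (real \<Rightarrow> real) \<Rightarrow> bool" where
  "radial_H10 n \<theta>\<^sub>1 u u' \<longleftrightarrow>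
     set_integrable lborel {0<..<\<theta>\<^sub>1} (\<lambda>\<theta>. ((u' \<theta>)\<^sup>2 + (u \<theta>)\<^sup>2) * sinh \<theta> powr (n - 1)) \<and>
     u \<theta>\<^sub>1 = 0"

text \<open>
  Derivatives on \<open>[0, \<theta>\<^sub>1]\<close> are one-sided at the endpoints.
\<close>

definition positive_solution :: "real \<Rightarrow> real \<Rightarrow> real \<Rightarrow> (real \<Rightarrow> real) \<Rightarrow> bool" where
  "positive_solution n \<theta>\<^sub>1 lam u \<longleftrightarrow>
     (\<exists>u' u''.
        (\<forall>\<theta> \<in> {0..\<theta>\<^sub>1}. (u has_real_derivative u' \<theta>) (at \<theta> within {0..\<theta>\<^sub>1})) \<and>
        continuous_on {0..\<theta>\<^sub>1} u' \<and>
        (\<forall>\<theta> \<in> {0<..<\<theta>\<^sub>1}. (u' has_real_derivative u'' \<theta>) (at \<theta>)) \<and>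
        continuous_on {0<..<\<theta>\<^sub>1} u'' \<and>
        (\<forall>\<theta> \<in> {0<..<\<theta>\<^sub>1}.
           - u'' \<theta> - (n - 1) * (cosh \<theta> / sinh \<theta>) * u' \<theta> =
             lam * u \<theta> + u \<theta> powr ((n + 2) / (n - 2))) \<and>
        radial_H10 n \<theta>\<^sub>1 u u' \<and>
        u' 0 = 0 \<and> u \<theta>\<^sub>1 = 0 \<and>
        (\<forall>\<theta> \<in> {0..<\<theta>\<^sub>1}. u \<theta> > 0))"

end

theory Submission
  imports Defs
begin

text \<open>
  Put \<open>\<beta> = (n - 2) / 2\<close>, \<open>L = \<lambda> - n (n - 2) / 4\<close>, and let a dot denote \<open>sinh \<theta> d/d\<theta>\<close>. Then
  \<open>y = sinh\<^sup>\<beta> \<theta> u\<close> satisfies \<open>y\<^sup>.\<^sup>. + (L sinh\<^sup>2 \<theta> - \<beta>\<^sup>2) y + y\<^sup>p = 0\<close>, and the linear part is solved by the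
  Legendre functions of order \<open>\<plusminus>\<beta>\<close>. These are \<open>coth\<^sup>\<beta> (\<theta>/2) A\<close> and \<open>tanh\<^sup>\<beta> (\<theta>/2) B\<close> up to constants,
  where \<open>A\<close> and \<open>B\<close> are hypergeometric functions of \<open>x = sinh\<^sup>2 (\<theta>/2)\<close> with third parameter
  \<open>c = 1 - \<beta>\<close> and \<open>c = 1 + \<beta>\<close>. If \<open>V\<^sub>1\<close> and \<open>V\<^sub>2\<close> denote the Wronskians of \<open>y\<close> with the two Legendre
  functions, the Pohozaev functional \<open>E = V\<^sub>1 V\<^sub>2 / 2 + A B y\<^bsup>p + 1\<^esup> / (p + 1)\<close> has dot derivative
  \<open>(1/2 + 1/(p + 1)) (A B)\<^sup>. y\<^bsup>p + 1\<^esup>\<close>. For \<open>0 < L \<le> L\<^sup>*\<close> a Sturm comparison makes \<open>A\<close> positive, which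
  forces \<open>B\<close> to be positive and both to decrease, so \<open>E\<close> decreases strictly. But \<open>E = 0\<close> at the centre
  and \<open>E \<ge> 0\<close> at \<open>\<theta>\<^sub>1\<close>.

  \<open>Lstar\<close> is a \<open>LEAST\<close>, so the existence of the minimum also has to be shown: it is the supremum of
  the \<open>L\<close> for which \<open>A\<close> has no zero up to \<open>\<theta>\<^sub>1\<close>.
\<close>

section \<open>Continuation of the hypergeometric function to a half-plane\<close>

text \<open>The quotient \<open>q n\<close> of consecutive coefficients tends to 1, so the ratio
  test gives convergence for every \<open>r\<close> below 1.\<close>

lemma fps_conv_radius_hypergeo_2_1:
  "fps_conv_radius (fps_hypergeo [a, b] [c] (1 :: complex)) \<ge> 1"
  unfolding fps_conv_radius_def
proof (rule conv_radius_geI_ex)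
  fix r :: real assume r: "0 < r" "ereal r < 1"
  define q where "q n = (a + of_nat n) * (b + of_nat n) / ((c + of_nat n) * of_nat (Suc n))" for n
  let ?F = "fps_hypergeo [a, b] [c] (1 :: complex)"
  have rec: "fps_nth ?F (Suc n) = q n * fps_nth ?F n" for n
    by (subst fps_hypergeo_rec) (simp add: q_def del: fps_hypergeo_nth of_nat_Suc)
  have lim1: "(\<lambda>n. (d + of_nat n) / of_nat n) \<longlonglongrightarrow> 1" for d :: complex
  proof -
    have "(\<lambda>n. d / of_nat n + 1) \<longlonglongrightarrow> 0 + 1"
      by (intro tendsto_intros lim_const_over_n)
    moreover have "\<forall>\<^sub>F n in sequentially. d / of_nat n + 1 = (d + of_nat n) / of_nat n"
      using eventually_gt_at_top[of 0] by eventually_elim (simp add: field_simps)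
    ultimately show ?thesis
      by (auto intro: Lim_transform_eventually)
  qed
  have "(\<lambda>n. ((a + of_nat n) / of_nat n) * ((b + of_nat n) / of_nat n) /
          (((c + of_nat n) / of_nat n) * ((1 + of_nat n) / of_nat n))) \<longlonglongrightarrow> 1 * 1 / (1 * 1)"
    by (intro tendsto_intros lim1) auto
  moreover have "\<forall>\<^sub>F n in sequentially. ((a + of_nat n) / of_nat n) * ((b + of_nat n) / of_nat n) /
          (((c + of_nat n) / of_nat n) * ((1 + of_nat n) / of_nat n)) = q n"
    using eventually_gt_at_top[of 0]
  proof eventually_elim
    case (elim n)
    have "x / m * (y / m) / (z / m * (w / m)) = x * y / (z * w)" if "m \<noteq> 0" for x y z w m :: complex
      using that by simp
    with elim show ?case by (simp add: q_def)
  qed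
  ultimately have "q \<longlonglongrightarrow> 1 * 1 / (1 * 1)"
    by (rule Lim_transform_eventually)
  then have "(\<lambda>n. norm (q n) * r) \<longlonglongrightarrow> norm (1 * 1 / (1 * 1) :: complex) * r"
    by (intro tendsto_intros)
  then have "(\<lambda>n. norm (q n) * r) \<longlonglongrightarrow> r" by simp
  moreover have "r < (1 + r) / 2" using r by (simp add: field_simps)
  ultimately have "\<forall>\<^sub>F n in sequentially. norm (q n) * r < (1 + r) / 2"
    by (rule order_tendstoD)
  then obtain N where N: "norm (q n) * r < (1 + r) / 2" if "n \<ge> N" for n
    by (auto simp: eventually_at_top_linorder)
  have "summable (\<lambda>n. fps_nth ?F n * of_real r ^ n)"
  proof (rule summable_ratio_test)
    show "(1 + r) / 2 < 1" using r by (simp add: field_simps)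
    fix n assume "N \<le> n"
    have "norm (fps_nth ?F (Suc n) * of_real r ^ Suc n) =
        (norm (q n) * r) * norm (fps_nth ?F n * of_real r ^ n)"
      using r by (simp add: rec norm_mult norm_power del: fps_hypergeo_nth)
    also have "\<dots> \<le> (1 + r) / 2 * norm (fps_nth ?F n * of_real r ^ n)"
      using N[OF \<open>N \<le> n\<close>] by (intro mult_right_mono) auto
    finally show "norm (fps_nth ?F (Suc n) * of_real r ^ Suc n) \<le>
        (1 + r) / 2 * norm (fps_nth ?F n * of_real r ^ n)" .
  qed
  then show "\<exists>z. norm z = r \<and> summable (\<lambda>n. fps_nth ?F n * z ^ n)"
    using r by (intro exI[of _ "of_real r"]) auto
qed

text \<open>The coefficient of degree \<open>k\<close> of the left side is the difference of the two
  sides of the recursion.\<close>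

lemma fps_hypergeo_ode_iff:
  fixes F :: "complex fps"
  shows "fps_X * (1 - fps_X) * fps_deriv (fps_deriv F)
      + (fps_const c - fps_const (a + b + 1) * fps_X) * fps_deriv F - fps_const (a * b) * F = 0 \<longleftrightarrow>
    (\<forall>k. (of_nat k + 1) * (c + of_nat k) * fps_nth F (Suc k) = (a + of_nat k) * (b + of_nat k) * fps_nth F k)"
  (is "?L = 0 \<longleftrightarrow> _")
proof -
  have "fps_nth ?L k = (of_nat k + 1) * (c + of_nat k) * fps_nth F (Suc k) - (a + of_nat k) * (b + of_nat k) * fps_nth F k" for k
  proof -
    have eq: "?L = fps_X * (fps_deriv (fps_deriv F)) - fps_X * (fps_X * fps_deriv (fps_deriv F))
       + fps_const c * fps_deriv F - fps_X * (fps_const (a + b + 1) * fps_deriv F) - fps_const (a * b) * F"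
      by (simp add: algebra_simps)
    show ?thesis
      unfolding eq
    proof (cases k)
      \<comment> \<open>The term \<open>X^2 F''\<close> shifts indices twice, so degrees 0, 1 and at
        least 2 are separate cases.\<close>
      case (Suc m)
      then show "fps_nth (fps_X * (fps_deriv (fps_deriv F)) - fps_X * (fps_X * fps_deriv (fps_deriv F))
       + fps_const c * fps_deriv F - fps_X * (fps_const (a + b + 1) * fps_deriv F) - fps_const (a * b) * F) k
       = (of_nat k + 1) * (c + of_nat k) * fps_nth F (Suc k) - (a + of_nat k) * (b + of_nat k) * fps_nth F k"
        by (cases m) (simp_all add: algebra_simps)
    qed simp
  qed
  then show ?thesis
    by (simp add: fps_eq_iff)
qed

text \<open>The expansion at 0 turns the equation near 0 into the recursion; the identity theorem
  carries it from a neighbourhood of 0 to all of the connected set \<open>A\<close>.\<close>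

lemma hypergeo_ode_iff:
  fixes f :: "complex \<Rightarrow> complex"
  assumes A: "open A" "connected A" "0 \<in> A" and hol: "f holomorphic_on A"
    and exp: "f has_fps_expansion F"
  shows "(\<forall>z\<in>A. z * (1 - z) * deriv (deriv f) z + (c - (a + b + 1) * z) * deriv f z - a * b * f z = 0) \<longleftrightarrow>
    (\<forall>k. (of_nat k + 1) * (c + of_nat k) * fps_nth F (Suc k) = (a + of_nat k) * (b + of_nat k) * fps_nth F k)"
proof -
  let ?D = "\<lambda>z. z * (1 - z) * deriv (deriv f) z + (c - (a + b + 1) * z) * deriv f z - a * b * f z"
  let ?F = "fps_X * (1 - fps_X) * fps_deriv (fps_deriv F)
      + (fps_const c - fps_const (a + b + 1) * fps_X) * fps_deriv F - fps_const (a * b) * F"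
  have D: "?D has_fps_expansion ?F"
    by (intro fps_expansion_intros exp)
  have "?F = 0" if "\<forall>z\<in>A. ?D z = 0"
  proof -
    have "\<forall>\<^sub>F z in nhds 0. z \<in> A" using A by (intro eventually_nhds_in_open)
    then have "\<forall>\<^sub>F z in nhds 0. ?D z = 0" by eventually_elim (use that in blast)
    then have "?D has_fps_expansion 0" by (simp add: has_fps_expansion_0_iff)
    with D show ?thesis by (rule fps_expansion_unique_complex)
  qed
  moreover have "?D z = 0" if F0: "?F = 0" and z: "z \<in> A" for z
  proof (rule has_fps_expansion_0_analytic_continuation[of ?D, OF _ _ A z])
    show "?D has_fps_expansion 0" using D unfolding F0 .
    show "?D holomorphic_on A" by (intro holomorphic_intros holomorphic_deriv hol A(1))
  qed
  ultimately show ?thesis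
    unfolding fps_hypergeo_ode_iff[symmetric] by blast
qed

section \<open>Pfaff's transformation and the continuation\<close>

text \<open>The derivatives of \<open>P\<close>, \<open>W\<close> and \<open>i\<close> are
  polynomials in \<open>a\<close>, \<open>P\<close> and \<open>i\<close>, and
  \<open>W = 1 - i\<close>. The equation for \<open>f\<close> thus follows by polynomial algebra
  from that for \<open>g\<close>, whose second parameter is \<open>c - b\<close>.\<close>

lemma pfaff_hypergeo_ode:
  fixes g g1 g2 :: "complex \<Rightarrow> complex"
  assumes g: "\<And>w. norm w < 1 \<Longrightarrow> (g has_field_derivative g1 w) (at w)"
    and g1: "\<And>w. norm w < 1 \<Longrightarrow> (g1 has_field_derivative g2 w) (at w)"
    and ode: "\<And>w. norm w < 1 \<Longrightarrow>
      w * (1 - w) * g2 w + (c - (a + (c - b) + 1) * w) * g1 w - a * (c - b) * g w = 0"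
  defines "f \<equiv> \<lambda>z. (1 - z) powr (- a) * g (z / (z - 1))"
  assumes z: "Re z < 1 / 2"
  shows "(f has_field_derivative deriv f z) (at z)"
    and "z * (1 - z) * deriv (deriv f) z + (c - (a + b + 1) * z) * deriv f z - a * b * f z = 0"
proof -
  define P where "P z = (1 - z) powr (- a)" for z
  define W where "W z = z / (z - 1)" for z :: complex
  define i where "i z = 1 / (1 - z)" for z :: complex
  define f1 where "f1 z = P z * (a * (i z * g (W z)) - i z ^ 2 * g1 (W z))" for z
  define f2 where "f2 z = a * P z * i z * (a * (i z * g (W z)) - i z ^ 2 * g1 (W z))
     + P z * (a * (i z ^ 2 * g (W z) - i z ^ 3 * g1 (W z)) - (2 * i z ^ 3 * g1 (W z) - i z ^ 4 * g2 (W z)))" for z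
  define H where "H = {z :: complex. Re z < 1 / 2}"
  have "open H" unfolding H_def by (rule open_halfspace_Re_lt)
  have ne: "1 - z \<noteq> 0" if "z \<in> H" for z
    using that by (auto simp: H_def)
  have W1: "norm (W z) < 1" if "z \<in> H" for z
  proof -
    \<comment> \<open>A point is nearer to 0 than to 1 exactly when
      \<open>Re z < 1 / 2\<close>.\<close>
    have "norm z ^ 2 < norm (z - 1) ^ 2"
      unfolding cmod_power2 using that by (simp add: H_def power2_eq_square algebra_simps)
    then have "norm z < norm (z - 1)"
      by (rule power2_less_imp_less) simp
    then show ?thesis
      by (auto simp: W_def norm_divide divide_simps)
  qed
  have dP: "(P has_field_derivative a * P z * i z) (at z)" if "z \<in> H" for z
  proof -
    have "1 - z \<notin> \<real>\<^sub>\<le>\<^sub>0" using that by (auto simp: H_def complex_nonpos_Reals_iff)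
    then have "(P has_field_derivative (- a * (1 - z) powr (- a - 1)) * (0 - 1)) (at z)"
      unfolding P_def
      by (auto intro!: derivative_eq_intros)
    moreover have "(1 - z) powr (- a - 1) = P z / (1 - z)"
      using ne[OF that] by (simp add: P_def powr_diff)
    ultimately show ?thesis by (simp add: i_def)
  qed
  have dW: "(W has_field_derivative - (i z ^ 2)) (at z)" if "z \<in> H" for z
  proof -
    have "z \<noteq> 1" using ne[OF that] by auto
    then have "(W has_field_derivative (1 * (z - 1) - z * 1) / ((z - 1) * (z - 1))) (at z)"
      unfolding W_def by (auto intro!: derivative_eq_intros)
    moreover have "(z - 1) * (z - 1) = (1 - z) ^ 2" by (simp add: power2_eq_square algebra_simps)
    ultimately show ?thesis by (simp add: i_def power_divide)
  qed
  have dgW: "((\<lambda>z. g (W z)) has_field_derivative g1 (W z) * - (i z ^ 2)) (at z)"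
    and dg1W: "((\<lambda>z. g1 (W z)) has_field_derivative g2 (W z) * - (i z ^ 2)) (at z)"
    if "z \<in> H" for z
    by (rule DERIV_chain2[OF g[OF W1] dW] DERIV_chain2[OF g1[OF W1] dW]; fact that)+
  have di: "(i has_field_derivative i z ^ 2) (at z)" if "z \<in> H" for z
    unfolding i_def using ne[OF that] by (auto intro!: derivative_eq_intros simp: power2_eq_square)
  have di2: "((\<lambda>z. i z ^ 2) has_field_derivative 2 * i z ^ 3) (at z)" if "z \<in> H" for z
    by (rule DERIV_cong[OF DERIV_power[OF di[OF that]]]) (simp add: power2_eq_square power3_eq_cube)
  have f_eq: "f = (\<lambda>z. P z * g (W z))" by (simp add: f_def P_def W_def)
  have df: "(f has_field_derivative f1 z) (at z)" if "z \<in> H" for z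
    unfolding f_eq
    by (rule DERIV_cong[OF DERIV_mult[OF dP dgW]])
      (use that in \<open>simp_all add: f1_def right_diff_distrib mult_ac\<close>)
  have dq: "((\<lambda>z. a * (i z * g (W z)) - i z ^ 2 * g1 (W z)) has_field_derivative
     a * (i z ^ 2 * g (W z) - i z ^ 3 * g1 (W z)) - (2 * i z ^ 3 * g1 (W z) - i z ^ 4 * g2 (W z))) (at z)"
    if "z \<in> H" for z
    by (rule DERIV_cong[OF DERIV_diff[OF DERIV_cmult[OF DERIV_mult[OF di dgW]] DERIV_mult[OF di2 dg1W]]])
      (use that in \<open>simp_all add: power2_eq_square power3_eq_cube power4_eq_xxxx right_diff_distrib mult_ac\<close>)
  have df1: "(f1 has_field_derivative f2 z) (at z)" if "z \<in> H" for z
    unfolding f1_def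
    by (rule DERIV_cong[OF DERIV_mult[OF dP dq]]) (use that in \<open>simp_all add: f2_def mult.commute\<close>)
  have zH: "z \<in> H" using z by (simp add: H_def)
  have deriv_f: "deriv f z = f1 z" if "z \<in> H" for z
    using df[OF that] by (rule DERIV_imp_deriv)
  have "(deriv f has_field_derivative f2 z) (at z)"
    by (rule has_field_derivative_transform_within_open[OF df1[OF zH] \<open>open H\<close> zH]) (simp add: deriv_f)
  then have deriv2: "deriv (deriv f) z = f2 z" by (rule DERIV_imp_deriv)
  show "(f has_field_derivative deriv f z) (at z)"
    using df[OF zH] by (simp add: deriv_f zH)
  have "(1 - z) * i z = 1" and "W z = 1 - i z"
    using ne[OF zH] by (auto simp: i_def W_def field_simps)
  moreover have "W z * (1 - W z) * g2 (W z) + (c - (a + (c - b) + 1) * W z) * g1 (W z)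
      - a * (c - b) * g (W z) = 0"
    by (rule ode[OF W1[OF zH]])
  ultimately have "z * (1 - z) * f2 z + (c - (a + b + 1) * z) * f1 z - a * b * (P z * g (W z)) = 0"
    unfolding f1_def f2_def by algebra
  then show "z * (1 - z) * deriv (deriv f) z + (c - (a + b + 1) * z) * deriv f z - a * b * f z = 0"
    by (simp only: deriv_f[OF zH] deriv2 f_eq[THEN fun_cong])
qed

text \<open>Pfaff's transformation: \<open>z \<mapsto> z / (z - 1)\<close> maps the half-plane into the unit disc.\<close>

lemma hyp2F1_half_plane:
  fixes a b c :: complex
  assumes c: "\<And>k. c + of_nat k \<noteq> 0"
  defines "H \<equiv> {z. Re z < 1 / 2}"
  shows "hyp2F1 a b c holomorphic_on H"
    and "hyp2F1 a b c 0 = 1"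
    and "\<And>z. z \<in> H \<Longrightarrow> z * (1 - z) * deriv (deriv (hyp2F1 a b c)) z
      + (c - (a + b + 1) * z) * deriv (hyp2F1 a b c) z - a * b * hyp2F1 a b c z = 0"
proof -
  have rec: "(of_nat k + 1) * (c + of_nat k) * fps_nth (fps_hypergeo [a', b'] [c] 1) (Suc k) =
      (a' + of_nat k) * (b' + of_nat k) * fps_nth (fps_hypergeo [a', b'] [c] 1) k" for a' b' k
    using c[of k] of_nat_neq_0[of k, where ?'a = complex]
    by (subst fps_hypergeo_rec) (simp add: add.commute del: fps_hypergeo_nth)
  have expn: "eval_fps (fps_hypergeo [a', b'] [c] 1) has_fps_expansion fps_hypergeo [a', b'] [c] 1"
    and hol: "eval_fps (fps_hypergeo [a', b'] [c] 1) holomorphic_on ball 0 1" for a' b'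
  proof -
    have *: "fps_conv_radius (fps_hypergeo [a', b'] [c] 1) \<ge> 1"
      by (rule fps_conv_radius_hypergeo_2_1)
    show "eval_fps (fps_hypergeo [a', b'] [c] 1) has_fps_expansion fps_hypergeo [a', b'] [c] 1"
      by (rule eval_fps_has_fps_expansion) (rule less_le_trans[OF _ *], simp)
    show "eval_fps (fps_hypergeo [a', b'] [c] 1) holomorphic_on ball 0 1"
      by (rule holomorphic_on_eval_fps)
        (auto simp: in_eball_iff intro!: less_le_trans[OF _ *])
  qed
  \<comment> \<open>Pfaff's formula supplies the candidate \<open>f\<close> for the continuation,
    built from the series \<open>g\<close> with \<open>b\<close> replaced by
    \<open>c - b\<close>.\<close>
  define g where "g = eval_fps (fps_hypergeo [a, c - b] [c] 1)"
  define f where "f z = (1 - z) powr (- a) * g (z / (z - 1))" for z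
  have ode_g: "w * (1 - w) * deriv (deriv g) w + (c - (a + (c - b) + 1) * w) * deriv g w
      - a * (c - b) * g w = 0" if "norm w < 1" for w
  proof -
    have "\<forall>z\<in>ball 0 1. z * (1 - z) * deriv (deriv g) z + (c - (a + (c - b) + 1) * z) * deriv g z
      - a * (c - b) * g z = 0"
      using rec unfolding g_def
      by (subst hypergeo_ode_iff[OF _ _ _ hol expn]) (simp_all del: fps_hypergeo_nth)
    with that show ?thesis by simp
  qed
  have g: "(g has_field_derivative deriv g w) (at w)"
    and g1: "(deriv g has_field_derivative deriv (deriv g) w) (at w)" if "norm w < 1" for w
    using that hol[of a "c - b"]
    by (auto simp: g_def intro!: holomorphic_derivI[where S = "ball 0 1"] holomorphic_deriv)
  note pf = pfaff_hypergeo_ode[OF g g1 ode_g, folded f_def]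
  have H: "open H" "convex H" "0 \<in> H"
    unfolding H_def by (rule open_halfspace_Re_lt, rule convex_halfspace_Re_lt, simp)
  then have "connected H" by (simp add: convex_connected)
  note H = H this
  have holf: "f holomorphic_on H"
    unfolding holomorphic_on_open[OF H(1)] using pf(1) by (auto simp: H_def simp del: less_divide_eq_numeral1)
  have g0: "g 0 = 1" by (simp add: g_def eval_fps_at_0)
  have f0: "f 0 = 1" by (simp add: f_def g0)
  have expf: "f has_fps_expansion fps_expansion f 0"
    by (rule has_fps_expansion_fps_expansion[OF H(1,3) holf])
  let ?F = "fps_hypergeo [a, b] [c] 1"
  \<comment> \<open>\<open>f\<close> solves the equation with parameters \<open>a\<close>,
    \<open>b\<close>, \<open>c\<close>, so its coefficients obey the recursion of \<open>?F\<close>;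
    as \<open>c + of_nat k\<close> never vanishes, the value 1 at 0 determines them all.\<close>
  have Feq: "fps_expansion f 0 = ?F"
  proof (rule fps_ext)
    fix k
    have recf: "(of_nat k + 1) * (c + of_nat k) * fps_nth (fps_expansion f 0) (Suc k) =
      (a + of_nat k) * (b + of_nat k) * fps_nth (fps_expansion f 0) k" for k
      using pf(2) hypergeo_ode_iff[OF H(1,4,3) holf expf, of c a b] by (auto simp: H_def)
    show "fps_nth (fps_expansion f 0) k = fps_nth ?F k"
    proof (induction k)
      case 0
      then show ?case by (simp add: fps_expansion_def f0)
    next
      case (Suc k)
      have "(of_nat k + 1) * (c + of_nat k) \<noteq> 0"
        using c[of k] of_nat_neq_0[of k, where ?'a = complex] by (simp add: add.commute)
      moreover have "(of_nat k + 1) * (c + of_nat k) * fps_nth (fps_expansion f 0) (Suc k) =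
          (of_nat k + 1) * (c + of_nat k) * fps_nth ?F (Suc k)"
        unfolding rec recf Suc.IH ..
      ultimately show ?case by (metis mult_left_cancel)
    qed
  qed
  have eq: "f x = eval_fps ?F x" if "x \<in> H \<inter> ball 0 1" for x
  proof -
    have "f x - eval_fps ?F x = 0"
    proof (rule has_fps_expansion_0_analytic_continuation[where A = "H \<inter> ball 0 1"
          and f = "\<lambda>x. f x - eval_fps ?F x"])
      have "(\<lambda>x. f x - eval_fps ?F x) has_fps_expansion fps_expansion f 0 - ?F"
        by (intro fps_expansion_intros expf expn)
      then show "(\<lambda>x. f x - eval_fps ?F x) has_fps_expansion 0" by (simp add: Feq)
      show "(\<lambda>x. f x - eval_fps ?F x) holomorphic_on H \<inter> ball 0 1"
        by (intro holomorphic_intros holomorphic_on_subset[OF holf] holomorphic_on_subset[OF hol]) auto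
    qed (use H that in \<open>auto intro!: convex_connected convex_Int\<close>)
    then show ?thesis by simp
  qed
  have eqf: "hyp2F1 a b c z = f z" if "z \<in> H" for z
    by (rule hyp2F1_eqI[OF H(1,2,3) that holf]) (rule eq, simp)
  show hol_hyp: "hyp2F1 a b c holomorphic_on H"
    using holf eqf by (metis holomorphic_cong)
  show "hyp2F1 a b c 0 = 1" using eqf H f0 by simp
  have d1: "deriv (hyp2F1 a b c) z = deriv f z" if "z \<in> H" for z
    by (rule complex_derivative_transform_within_open[OF hol_hyp holf H(1) that eqf])
  have d2: "deriv (deriv (hyp2F1 a b c)) z = deriv (deriv f) z" if "z \<in> H" for z
    by (rule complex_derivative_transform_within_open[OF _ _ H(1) that d1])
      (intro holomorphic_deriv hol_hyp holf H(1))+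
  show "z * (1 - z) * deriv (deriv (hyp2F1 a b c)) z
      + (c - (a + b + 1) * z) * deriv (hyp2F1 a b c) z - a * b * hyp2F1 a b c z = 0" if "z \<in> H" for z
    using pf(2)[of z] that by (simp add: d1 d2 eqf H_def)
qed

section \<open>The hypergeometric equation on the half-line\<close>

text \<open>The compact set where \<open>f\<close> is nonpositive has a least point, and by the
  intermediate value theorem \<open>f\<close> vanishes there.\<close>

lemma first_zero:
  fixes f :: "real \<Rightarrow> real"
  assumes cont: "continuous_on {0..r} f" and "f 0 > 0" and x: "x \<in> {0..r}" "f x \<le> 0"
  obtains x0 where "0 < x0" "x0 \<le> r" "f x0 = 0" "\<And>y. 0 \<le> y \<Longrightarrow> y < x0 \<Longrightarrow> f y > 0"
proof -
  define S where "S = {0..r} \<inter> f -` {..0}"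
  have "closed S"
    unfolding S_def by (intro continuous_closed_preimage cont) auto
  then have "compact S"
    by (simp add: compact_eq_bounded_closed S_def bounded_Int)
  moreover have "x \<in> S" using x by (simp add: S_def)
  ultimately obtain x0 where x0: "x0 \<in> S" "\<And>y. y \<in> S \<Longrightarrow> x0 \<le> y"
    using compact_attains_inf[of S] by auto
  have pos: "f y > 0" if "0 \<le> y" "y < x0" for y
    using x0 that by (force simp: S_def)
  have "f x0 \<le> 0" "0 \<le> x0" "x0 \<le> r" using x0 by (auto simp: S_def)
  moreover have "x0 \<noteq> 0" using \<open>f x0 \<le> 0\<close> \<open>f 0 > 0\<close> by auto
  ultimately have "0 < x0" "x0 \<le> r" by auto
  moreover have "f x0 = 0"
  proof -
    obtain y where "0 \<le> y" "y \<le> x0" "f y = 0"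
      using IVT2'[of f x0 0 0] \<open>f x0 \<le> 0\<close> \<open>f 0 > 0\<close> \<open>0 \<le> x0\<close> \<open>x0 \<le> r\<close>
        continuous_on_subset[OF cont, of "{0..x0}"] by auto
    then show ?thesis using pos[of y] by (cases "y = x0") auto
  qed
  ultimately show ?thesis using pos that[of x0] by simp
qed

lemma nonneg_at_right_endpoint:
  fixes f :: "real \<Rightarrow> real"
  assumes cont: "continuous_on {0..r} f" and "0 < r" and pos: "\<And>x. 0 \<le> x \<Longrightarrow> x < r \<Longrightarrow> f x > 0"
  shows "0 \<le> f r"
proof (rule ccontr)
  assume neg: "\<not> 0 \<le> f r"
  then obtain t where "0 < t" "t \<le> r" "f t = 0"
    using first_zero[OF cont, of r] pos[of 0] \<open>0 < r\<close> by auto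
  with pos[of t] neg show False by (cases "t = r") auto
qed

text \<open>The integrating factor is \<open>x\<^sup>c (1 + x)\<^bsup>2 - c\<^esup>\<close>, which vanishes at the singular point \<open>0\<close>; hence no
  initial value is needed.\<close>

lemma
  fixes c :: real
  assumes c: "0 < c" and r: "0 < r" and cont: "continuous_on {0..r} v"
    and deriv: "\<And>x. 0 < x \<Longrightarrow> x < r \<Longrightarrow> (v has_real_derivative v' x) (at x)"
  shows singular_first_order_nonneg:
      "(\<And>x. 0 < x \<Longrightarrow> x < r \<Longrightarrow> x * (1 + x) * v' x + (c + 2 * x) * v x \<ge> 0) \<Longrightarrow> v r \<ge> 0"
    and singular_first_order_pos:
      "(\<And>x. 0 < x \<Longrightarrow> x < r \<Longrightarrow> x * (1 + x) * v' x + (c + 2 * x) * v x > 0) \<Longrightarrow> v r > 0"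
proof -
  define p where "p x = x powr c * (1 + x) powr (2 - c)" for x :: real
  define q where "q x = x powr (c - 1) * (1 + x) powr (1 - c)" for x :: real
  have dp: "(p has_real_derivative q x * (c + 2 * x)) (at x)" if "0 < x" for x
  proof -
    have "(p has_real_derivative c * x powr (c - 1) * (1 + x) powr (2 - c)
        + x powr c * ((2 - c) * (1 + x) powr (2 - c - 1))) (at x)"
      unfolding p_def using that by (auto intro!: derivative_eq_intros)
    moreover have "x powr c = x * x powr (c - 1)" "(1 + x) powr (2 - c) = (1 + x) * (1 + x) powr (1 - c)"
      using that powr_add[of x 1 "c - 1"] powr_add[of "1 + x" 1 "1 - c"] by auto
    ultimately show ?thesis by (simp add: q_def algebra_simps)
  qed
  have pq: "p x = q x * (x * (1 + x))" if "0 < x" for x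
    using that powr_add[of x 1 "c - 1"] powr_add[of "1 + x" 1 "1 - c"] by (simp add: p_def q_def)
  have q: "0 < q x" if "0 < x" for x using that by (simp add: q_def)
  have d: "((\<lambda>x. p x * v x) has_real_derivative q x * (x * (1 + x) * v' x + (c + 2 * x) * v x)) (at x)"
    if "0 < x" "x < r" for x
    by (rule DERIV_cong[OF DERIV_mult[OF dp deriv]]) (use that in \<open>simp_all add: pq algebra_simps\<close>)
  have "continuous_on {0..r} p"
    unfolding p_def using c by (intro continuous_intros continuous_on_powr') auto
  then have cpv: "continuous_on {0..r} (\<lambda>x. p x * v x)" by (intro continuous_intros cont)
  have p0: "p 0 = 0" by (simp add: p_def)
  have pr: "0 < p r" using r by (simp add: p_def)
  show "v r \<ge> 0" if "\<And>x. 0 < x \<Longrightarrow> x < r \<Longrightarrow> x * (1 + x) * v' x + (c + 2 * x) * v x \<ge> 0"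
  proof -
    have "p 0 * v 0 \<le> p r * v r"
      by (rule DERIV_nonneg_imp_increasing_open[OF less_imp_le[OF r] _ cpv])
        (rule exI, rule conjI, erule (1) d, use that q in \<open>simp add: less_imp_le\<close>)
    then show ?thesis using p0 pr by (simp add: zero_le_mult_iff)
  qed
  show "v r > 0" if "\<And>x. 0 < x \<Longrightarrow> x < r \<Longrightarrow> x * (1 + x) * v' x + (c + 2 * x) * v x > 0"
  proof -
    have "p 0 * v 0 < p r * v r"
      by (rule DERIV_pos_imp_increasing_open[OF r _ cpv]) (rule exI, rule conjI, erule (1) d, use that q in simp)
    then show ?thesis using p0 pr by (simp add: zero_less_mult_iff)
  qed
qed

text \<open>A Gronwall estimate, obtained by maximising \<open>\<bar>d x\<bar> e\<^bsup>- k x\<^esup>\<close> with \<open>k = 2 M / c\<close>.\<close>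

lemma hypergeo_ode_perturbation:
  fixes c M \<epsilon> R :: real
  assumes c: "0 < c" and M: "0 < M" and R: "0 < R" and d0: "d 0 = 0"
    and d: "\<And>x. x \<in> {0..R} \<Longrightarrow> (d has_real_derivative d1 x) (at x)"
    and d1: "\<And>x. x \<in> {0..R} \<Longrightarrow> (d1 has_real_derivative d2 x) (at x)"
    and ode: "\<And>x. x \<in> {0..R} \<Longrightarrow> \<bar>x * (1 + x) * d2 x + (c + 2 * x) * d1 x + M * d x\<bar> \<le> \<epsilon>"
    and x: "x \<in> {0..R}"
  shows "\<bar>d x\<bar> \<le> 2 * \<epsilon> * R / c * exp (2 * M * R / c)"
proof -
  define k where "k = 2 * M / c"
  have k: "0 < k" using c M by (simp add: k_def)
  have eps: "0 \<le> \<epsilon>" using ode[OF x] by linarith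
  have cd: "continuous_on {0..R} d" and cd1: "continuous_on {0..R} d1"
    by (rule DERIV_continuous_on, erule has_field_derivative_at_within[OF d])
      (rule DERIV_continuous_on, erule has_field_derivative_at_within[OF d1])
  have "continuous_on {0..R} (\<lambda>x. \<bar>d x\<bar> * exp (- (k * x)))"
    by (intro continuous_intros cd)
  then obtain y where y: "y \<in> {0..R}"
    and max: "\<And>x. x \<in> {0..R} \<Longrightarrow> \<bar>d x\<bar> * exp (- (k * x)) \<le> \<bar>d y\<bar> * exp (- (k * y))"
    using continuous_attains_sup[OF compact_Icc, of 0 R "\<lambda>x. \<bar>d x\<bar> * exp (- (k * x))"] R by auto
  define N where "N = \<bar>d y\<bar> * exp (- (k * y))"
  have N0: "0 \<le> N" by (simp add: N_def)
  have dN: "\<bar>d x\<bar> \<le> N * exp (k * x)" if "x \<in> {0..R}" for x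
    using max[OF that, folded N_def] by (simp add: exp_minus field_simps)
  have d1_bound: "\<bar>d1 x\<bar> \<le> (\<epsilon> + M * N * exp (k * x)) / c" if x: "x \<in> {0..R}" for x
  proof -
    define m where "m = \<epsilon> + M * N * exp (k * x)"
    have m0: "0 \<le> m" using eps N0 M by (simp add: m_def)
    \<comment> \<open>On \<open>[0, x]\<close> the zeroth-order term is at most
      \<open>M * N * exp (k * x)\<close>, so the equation is a first-order one for \<open>d1\<close>
      with right side bounded by \<open>m\<close>.\<close>
    have rhs: "\<bar>z * (1 + z) * d2 z + (c + 2 * z) * d1 z\<bar> \<le> m" if "0 \<le> z" "z \<le> x" for z
    proof -
      have z: "z \<in> {0..R}" using that x by auto
      have "\<bar>d z\<bar> \<le> N * exp (k * z)" by (rule dN[OF z])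
      also have "\<dots> \<le> N * exp (k * x)" using that k N0 by (intro mult_left_mono) auto
      finally have "M * \<bar>d z\<bar> \<le> M * (N * exp (k * x))" using M by simp
      moreover have "M * \<bar>d z\<bar> = \<bar>M * d z\<bar>" using M by (simp add: abs_mult)
      ultimately show ?thesis using ode[OF z] unfolding m_def mult.assoc[of M N] by linarith
    qed
    have "\<bar>d1 x\<bar> \<le> m / c"
    proof (cases "x = 0")
      case True
      have "c * \<bar>d1 x\<bar> \<le> m" using rhs[of 0] True c by (simp add: abs_mult)
      then show ?thesis using c by (simp add: field_simps)
    next
      case False
      then have x0: "0 < x" using x by auto
      have cont: "continuous_on {0..x} d1" using x by (auto intro: continuous_on_subset[OF cd1])
      \<comment> \<open>Adding the constant \<open>m / c\<close> to either sign of \<open>d1\<close>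
        makes the first-order expression nonnegative.\<close>
      have sgn: "s * d1 x + m / c \<ge> 0" if s: "s = 1 \<or> s = - 1" for s
      proof (rule singular_first_order_nonneg[OF c x0])
        show "continuous_on {0..x} (\<lambda>x. s * d1 x + m / c)" by (intro continuous_intros cont)
        fix z assume z: "0 < z" "z < x"
        then show "((\<lambda>x. s * d1 x + m / c) has_real_derivative s * d2 z) (at z)"
          using x by (auto intro!: derivative_eq_intros d1)
        have "- m \<le> s * (z * (1 + z) * d2 z + (c + 2 * z) * d1 z)"
          using rhs[of z] z s by (auto simp: abs_le_iff)
        moreover have "m \<le> (c + 2 * z) * (m / c)"
          using c z m0 by (simp add: field_simps)
        moreover have "z * (1 + z) * (s * d2 z) + (c + 2 * z) * (s * d1 z + m / c)
          = s * (z * (1 + z) * d2 z + (c + 2 * z) * d1 z) + (c + 2 * z) * (m / c)"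
          by (simp add: algebra_simps)
        ultimately show "z * (1 + z) * (s * d2 z) + (c + 2 * z) * (s * d1 z + m / c) \<ge> 0"
          by linarith
      qed
      show ?thesis using sgn[of 1] sgn[of "- 1"] by (simp add: abs_le_iff)
    qed
    then show ?thesis by (simp add: m_def)
  qed
  \<comment> \<open>The bound on \<open>d1\<close> is integrated from 0, where \<open>d\<close>
    vanishes.\<close>
  have sd: "s * d y \<le> (\<epsilon> * y + M * N * (exp (k * y) - 1) / k) / c" if s: "s = 1 \<or> s = - 1" for s
  proof -
    let ?h = "\<lambda>x. (\<epsilon> * x + M * N * (exp (k * x) - 1) / k) / c - s * d x"
    have "?h 0 \<le> ?h y"
    proof (rule DERIV_nonneg_imp_nondecreasing[where f = ?h])
      show "0 \<le> y" using y by simp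
      fix x assume "0 \<le> x" "x \<le> y"
      then have x: "x \<in> {0..R}" using y by auto
      have "(?h has_real_derivative (\<epsilon> + M * N * exp (k * x)) / c - s * d1 x) (at x)"
        using k c by (auto intro!: derivative_eq_intros d[OF x])
      moreover have "s * d1 x \<le> (\<epsilon> + M * N * exp (k * x)) / c"
        using d1_bound[OF x] s by auto
      ultimately show "\<exists>D. (?h has_real_derivative D) (at x) \<and> 0 \<le> D" by (meson diff_ge_0_iff_ge)
    qed
    then show ?thesis using d0 by simp
  qed
  have "\<bar>d y\<bar> \<le> (\<epsilon> * y + M * N * (exp (k * y) - 1) / k) / c"
    using sd[of 1] sd[of "- 1"] by (simp add: abs_le_iff)
  \<comment> \<open>The choice of \<open>k\<close> makes \<open>M / (c * k)\<close> equal to 1/2, so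
    that half of \<open>N * exp (k * y)\<close> can be absorbed on the left.\<close>
  also have "\<dots> = \<epsilon> * y / c + N * exp (k * y) / 2 - N / 2"
    using c M by (simp add: k_def field_simps)
  also have "\<bar>d y\<bar> = N * exp (k * y)"
    by (simp add: N_def exp_minus)
  finally have "N * exp (k * y) \<le> 2 * (\<epsilon> * y / c)" using N0 by linarith
  moreover have "\<epsilon> * y / c \<le> \<epsilon> * R / c" using y eps c by (intro divide_right_mono mult_left_mono) auto
  moreover have "N \<le> N * exp (k * y)" using N0 y k by (simp add: mult_le_cancel_left1)
  ultimately have N: "N \<le> 2 * \<epsilon> * R / c" by simp
  have "\<bar>d x\<bar> \<le> N * exp (k * x)" by (rule dN[OF x])
  also have "\<dots> \<le> 2 * \<epsilon> * R / c * exp (2 * M * R / c)"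
  proof (intro mult_mono N)
    show "exp (k * x) \<le> exp (2 * M * R / c)"
      using x M c by (simp add: k_def divide_right_mono)
    show "0 \<le> 2 * \<epsilon> * R / c" using eps R c by simp
  qed simp
  finally show ?thesis .
qed

text \<open>\<open>A x\<close> stands for the value at \<open>- x\<close> of the hypergeometric function with parameters \<open>- l\<close>, \<open>l + 1\<close>, \<open>c\<close>,
  where \<open>L = - l (l + 1)\<close>.\<close>

definition hyp_sol :: "real \<Rightarrow> real \<Rightarrow> (real \<Rightarrow> real) \<Rightarrow> (real \<Rightarrow> real) \<Rightarrow> (real \<Rightarrow> real) \<Rightarrow> bool" where
  "hyp_sol c L A A1 A2 \<longleftrightarrow> A 0 = 1 \<and>
     (\<forall>x\<ge>0. (A has_real_derivative A1 x) (at x) \<and> (A1 has_real_derivative A2 x) (at x) \<and>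
        x * (1 + x) * A2 x + (c + 2 * x) * A1 x + L * A x = 0)"

lemma hyp_solD:
  assumes "hyp_sol c L A A1 A2"
  shows "A 0 = 1"
    and "0 \<le> x \<Longrightarrow> (A has_real_derivative A1 x) (at x)"
    and "0 \<le> x \<Longrightarrow> (A1 has_real_derivative A2 x) (at x)"
    and "0 \<le> x \<Longrightarrow> x * (1 + x) * A2 x = - (c + 2 * x) * A1 x - L * A x"
proof -
  show "A 0 = 1"
    and "0 \<le> x \<Longrightarrow> (A has_real_derivative A1 x) (at x)"
    and "0 \<le> x \<Longrightarrow> (A1 has_real_derivative A2 x) (at x)"
    using assms by (auto simp: hyp_sol_def)
  assume "0 \<le> x"
  then have "x * (1 + x) * A2 x + (c + 2 * x) * A1 x + L * A x = 0"
    using assms by (auto simp: hyp_sol_def)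
  then show "x * (1 + x) * A2 x = - (c + 2 * x) * A1 x - L * A x" by algebra
qed

lemma hyp_sol_continuous:
  assumes "hyp_sol c L A A1 A2" "0 \<le> s"
  shows "continuous_on {s..r} A" "continuous_on {s..r} A1"
  by (rule DERIV_continuous_on, rule has_field_derivative_at_within, rule hyp_solD(2)[OF assms(1)],
      use assms(2) in simp)
    (rule DERIV_continuous_on, rule has_field_derivative_at_within, rule hyp_solD(3)[OF assms(1)],
      use assms(2) in simp)

section \<open>Monotonicity, comparison and dependence on \<open>L\<close>\<close>

text \<open>Read as a first-order equation for \<open>- A1\<close>, the equation has the positive
  right side \<open>L * A x\<close>.\<close>

lemma hyp_sol_decreasing:
  assumes A: "hyp_sol c L A A1 A2" and c: "0 < c" and L: "0 < L" and r: "0 < r"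
    and pos: "\<And>x. 0 \<le> x \<Longrightarrow> x < r \<Longrightarrow> A x > 0"
  shows "A1 r < 0" and "A r < 1"
proof -
  have neg: "A1 s < 0" if "0 < s" "s \<le> r" for s
  proof -
    have "- A1 s > 0"
    proof (rule singular_first_order_pos[OF c \<open>0 < s\<close>])
      show "continuous_on {0..s} (\<lambda>x. - A1 x)"
        by (intro continuous_intros hyp_sol_continuous[OF A]) simp
      fix x assume x: "0 < x" "x < s"
      then show "((\<lambda>x. - A1 x) has_real_derivative - A2 x) (at x)"
        by (auto intro!: derivative_eq_intros hyp_solD(3)[OF A])
      have "x * (1 + x) * A2 x = - (c + 2 * x) * A1 x - L * A x"
        using hyp_solD(4)[OF A] x by simp
      then have "x * (1 + x) * - A2 x + (c + 2 * x) * - A1 x = L * A x" by algebra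
      then show "x * (1 + x) * - A2 x + (c + 2 * x) * - A1 x > 0"
        using pos[of x] x that L by simp
    qed
    then show ?thesis by simp
  qed
  then show "A1 r < 0" using r by simp
  have "A r < A 0"
    by (rule DERIV_neg_imp_decreasing_open[OF r _ hyp_sol_continuous(1)[OF A]])
      (rule exI, rule conjI, rule hyp_solD(2)[OF A], use neg in auto)
  then show "A r < 1" using hyp_solD(1)[OF A] by simp
qed

text \<open>Up to a first zero \<open>s\<close> of \<open>A\<close> the Wronskian \<open>?W\<close>
  has the positive source \<open>(M - L) * (A x * B x)\<close>, so it is positive at
  \<open>s\<close>. There, however, it equals \<open>A1 s * B s\<close> with \<open>A1 s < 0\<close>
  and \<open>B s \<ge> 0\<close>. The conclusion covers the endpoint \<open>r\<close>, where
  \<open>B\<close> may vanish.\<close>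

lemma hyp_sol_sturm:
  assumes A: "hyp_sol c L A A1 A2" and B: "hyp_sol c M B B1 B2"
    and c: "0 < c" and L: "0 < L" "L < M" and r: "0 < r"
    and pos: "\<And>x. 0 \<le> x \<Longrightarrow> x < r \<Longrightarrow> B x > 0" and x: "x \<in> {0..r}"
  shows "A x > 0"
proof (rule ccontr)
  assume "\<not> A x > 0"
  then have nonpos: "A x \<le> 0" by simp
  obtain s where s: "0 < s" "s \<le> r" "A s = 0" and posA: "\<And>y. 0 \<le> y \<Longrightarrow> y < s \<Longrightarrow> A y > 0"
    by (rule first_zero[OF hyp_sol_continuous(1)[OF A order_refl] _ x])
      (simp_all add: hyp_solD(1)[OF A] nonpos)
  let ?W = "\<lambda>x. A1 x * B x - A x * B1 x"
  have "?W s > 0"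
  proof (rule singular_first_order_pos[OF c s(1)])
    show "continuous_on {0..s} ?W"
      by (intro continuous_intros hyp_sol_continuous[OF A] hyp_sol_continuous[OF B]) simp_all
    fix x assume x: "0 < x" "x < s"
    have "(?W has_real_derivative (A2 x * B x + B1 x * A1 x) - (A1 x * B1 x + B2 x * A x)) (at x)"
      using x by (intro DERIV_diff DERIV_mult hyp_solD[OF A] hyp_solD[OF B]) simp_all
    then show "(?W has_real_derivative A2 x * B x - A x * B2 x) (at x)"
      by (simp add: mult_ac)
    have "x * (1 + x) * A2 x = - (c + 2 * x) * A1 x - L * A x"
      "x * (1 + x) * B2 x = - (c + 2 * x) * B1 x - M * B x"
      using hyp_solD(4)[OF A] hyp_solD(4)[OF B] x by simp_all
    then have "x * (1 + x) * (A2 x * B x - A x * B2 x) + (c + 2 * x) * ?W x = (M - L) * (A x * B x)"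
      by algebra
    then show "x * (1 + x) * (A2 x * B x - A x * B2 x) + (c + 2 * x) * ?W x > 0"
      using pos[of x] posA[of x] x s L by simp
  qed
  moreover have "A1 s < 0" by (rule hyp_sol_decreasing(1)[OF A c L(1) s(1) posA])
  moreover have "0 \<le> B s"
    by (rule nonneg_at_right_endpoint[OF hyp_sol_continuous(1)[OF B order_refl] s(1)])
      (use pos s in auto)
  ultimately show False using s(3) by (simp add: mult_less_0_iff zero_less_mult_iff)
qed

text \<open>The difference solves the equation of \<open>B\<close> up to the error
  \<open>(M - L) * A x\<close>.\<close>

lemma hyp_sol_perturbation:
  assumes A: "hyp_sol c L A A1 A2" and B: "hyp_sol c M B B1 B2"
    and c: "0 < c" and M: "0 < M" and R: "0 < R"
    and bound: "\<And>x. x \<in> {0..R} \<Longrightarrow> \<bar>A x\<bar> \<le> 1" and x: "x \<in> {0..R}"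
  shows "\<bar>A x - B x\<bar> \<le> 2 * \<bar>M - L\<bar> * R / c * exp (2 * M * R / c)"
proof (rule hypergeo_ode_perturbation[OF c M R _ _ _ _ x, where d = "\<lambda>x. A x - B x"])
  show "A 0 - B 0 = 0" using hyp_solD(1)[OF A] hyp_solD(1)[OF B] by simp
  fix x assume x: "x \<in> {0..R}"
  then show "((\<lambda>x. A x - B x) has_real_derivative A1 x - B1 x) (at x)"
    and "((\<lambda>x. A1 x - B1 x) has_real_derivative A2 x - B2 x) (at x)"
    by (auto intro!: derivative_intros hyp_solD[OF A] hyp_solD[OF B])
  have "x * (1 + x) * A2 x = - (c + 2 * x) * A1 x - L * A x"
    "x * (1 + x) * B2 x = - (c + 2 * x) * B1 x - M * B x"
    using hyp_solD(4)[OF A] hyp_solD(4)[OF B] x by simp_all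
  then have "x * (1 + x) * (A2 x - B2 x) + (c + 2 * x) * (A1 x - B1 x) + M * (A x - B x) = (M - L) * A x"
    by algebra
  moreover have "\<bar>(M - L) * A x\<bar> \<le> \<bar>M - L\<bar>"
    using bound[OF x] by (simp add: abs_mult mult_left_le)
  ultimately show "\<bar>x * (1 + x) * (A2 x - B2 x) + (c + 2 * x) * (A1 x - B1 x) + M * (A x - B x)\<bar> \<le> \<bar>M - L\<bar>"
    by (simp only:)
qed

text \<open>A positive solution has \<open>w = - A' / A\<close> satisfying a Riccati inequality
  \<open>w' \<ge> w\<^sup>2 / 2 + k\<^sup>2 / 2\<close> on \<open>[R / 2, R]\<close>, whose solutions blow up when \<open>k\<close> is large.\<close>

lemma hyp_sol_positive_imp_bounded:
  fixes c R :: real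
  assumes c: "0 < c" and R: "0 < R"
  obtains K where "\<And>L A A1 A2. hyp_sol c L A A1 A2 \<Longrightarrow> 0 \<le> L \<Longrightarrow>
    (\<And>x. x \<in> {0..R} \<Longrightarrow> A x > 0) \<Longrightarrow> L \<le> K"
proof -
  \<comment> \<open>On \<open>[R / 2, R]\<close>, \<open>g\<close> bounds the drift
    \<open>(c + 2 * x) / (x * (1 + x))\<close> from above and \<open>m\<close> bounds
    \<open>1 / (x * (1 + x))\<close> from below. Growth at rate \<open>k / 2\<close> over this
    interval amounts to \<open>pi\<close>.\<close>
  define k where "k = 4 * pi / R"
  define g where "g = 2 * (c + 2 * R) / R"
  define m where "m = 1 / (R * (1 + R))"
  have k: "0 < k" and m: "0 < m" using R by (simp_all add: k_def m_def)
  have "L \<le> (k\<^sup>2 + g\<^sup>2) / (2 * m)"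
    if A: "hyp_sol c L A A1 A2" and L: "0 \<le> L" and pos: "\<And>x. x \<in> {0..R} \<Longrightarrow> A x > 0" for L A A1 A2
  proof (rule ccontr)
    assume "\<not> L \<le> (k\<^sup>2 + g\<^sup>2) / (2 * m)"
    then have Lm: "k\<^sup>2 + g\<^sup>2 < 2 * (L * m)" using m by (simp add: field_simps)
    define w where "w x = - A1 x / A x" for x
    define w' where "w' x = (w x)\<^sup>2 - (c + 2 * x) / (x * (1 + x)) * w x + L / (x * (1 + x))" for x
    have dw: "(w has_real_derivative w' x) (at x)" if x: "x \<in> {R/2..R}" for x
    proof -
      have x0: "0 < x" and x1: "x \<in> {0..R}" using x R by auto
      have Ax: "A x \<noteq> 0" using pos[OF x1] by simp
      have "(w has_real_derivative ((- A2 x) * A x - (- A1 x) * A1 x) / (A x * A x)) (at x)"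
        unfolding w_def using x0 Ax
        by (intro DERIV_divide DERIV_minus hyp_solD[OF A]) auto
      moreover have "((- A2 x) * A x - (- A1 x) * A1 x) / (A x * A x) = w' x"
      proof -
        define i Y where "i = 1 / A x" and "Y = 1 / (x * (1 + x))"
        have "A x * i = 1" "x * (1 + x) * Y = 1" using x0 Ax by (simp_all add: i_def Y_def)
        moreover have "x * (1 + x) * A2 x = - (c + 2 * x) * A1 x - L * A x"
          using hyp_solD(4)[OF A, of x] x0 by simp
        ultimately have "((- A2 x) * A x - (- A1 x) * A1 x) * (i * i)
            = (- A1 x * i)\<^sup>2 - (c + 2 * x) * Y * (- A1 x * i) + L * Y"
          by algebra
        then show ?thesis by (simp add: w'_def w_def i_def Y_def)
      qed
      ultimately show ?thesis by simp
    qed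
    have w'_ge: "k\<^sup>2 + (w x)\<^sup>2 \<le> 2 * w' x" if x: "x \<in> {R/2..R}" for x
    proof -
      have x0: "0 < x" "R \<le> 2 * x" "x \<le> R" using x R by auto
      define h where "h = (c + 2 * x) / (x * (1 + x))"
      have h0: "0 \<le> h" using x0 c by (simp add: h_def)
      have "h \<le> (c + 2 * x) / x"
        unfolding h_def using x0 c by (intro divide_left_mono) auto
      also have "\<dots> \<le> (c + 2 * R) / (R / 2)"
        using x0 c R by (intro frac_le) auto
      finally have "h \<le> g" by (simp add: g_def mult.commute)
      then have hg: "h\<^sup>2 \<le> g\<^sup>2" using h0 by (intro power_mono)
      have "x * (1 + x) \<le> R * (1 + R)" using x0 by (intro mult_mono) auto
      define Q where "Q = L / (x * (1 + x))"
      have "L * m \<le> Q"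
        unfolding m_def Q_def using x0 L \<open>x * (1 + x) \<le> R * (1 + R)\<close> by (simp add: divide_left_mono)
      \<comment> \<open>Completing the square trades half of the quadratic term for the drift term,
        at the cost of \<open>h^2 / 2\<close>.\<close>
      moreover have "(w x - h)\<^sup>2 \<ge> 0" by simp
      then have "2 * ((w x)\<^sup>2 - h * w x) \<ge> (w x)\<^sup>2 - h\<^sup>2"
        by (simp add: power2_eq_square algebra_simps)
      ultimately show ?thesis
        unfolding w'_def h_def[symmetric] Q_def[symmetric] using hg Lm by argo
    qed
    \<comment> \<open>\<open>arctan (w x / k)\<close> grows at rate at least \<open>k / 2\<close>,
      hence by at least \<open>pi\<close> over the interval, but its values lie strictly between
      \<open>- pi / 2\<close> and \<open>pi / 2\<close>.\<close>
    let ?h = "\<lambda>x. arctan (w x / k) - k / 2 * x"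
    have "?h (R/2) \<le> ?h R"
    proof (rule DERIV_nonneg_imp_nondecreasing[where f = ?h])
      show "R / 2 \<le> R" using R by simp
      fix x assume "R / 2 \<le> x" "x \<le> R"
      then have x: "x \<in> {R/2..R}" by simp
      have "(?h has_real_derivative (inverse (1 + (w x / k)\<^sup>2) * (w' x / k) - k / 2)) (at x)"
        using k by (auto intro!: derivative_eq_intros dw[OF x])
      moreover have "inverse (1 + (w x / k)\<^sup>2) * (w' x / k) = w' x * k / (k\<^sup>2 + (w x)\<^sup>2)"
        using k by (simp add: field_simps power2_eq_square)
      moreover have "k / 2 \<le> w' x * k / (k\<^sup>2 + (w x)\<^sup>2)"
      proof -
        have "0 < k\<^sup>2 + (w x)\<^sup>2" using k by (simp add: add_pos_nonneg)
        then show ?thesis using mult_right_mono[OF w'_ge[OF x], of k] k by (simp add: field_simps)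
      qed
      ultimately show "\<exists>D. (?h has_real_derivative D) (at x) \<and> 0 \<le> D" by force
    qed
    moreover have "k / 2 * R - k / 2 * (R / 2) = pi" using R by (simp add: k_def)
    ultimately show False using arctan_bounded[of "w R / k"] arctan_bounded[of "w (R/2) / k"] by linarith
  qed
  then show ?thesis using that by blast
qed

text \<open>A positive solution has a positive minimum \<open>\<delta>\<close> on the compact
  interval, and a small increase of the parameter moves the solution by less than
  \<open>\<delta>\<close>.\<close>

lemma hyp_sol_positive_open:
  assumes A: "hyp_sol c L A A1 A2" and c: "0 < c" and L: "0 \<le> L" and R: "0 < R"
    and pos: "\<And>x. x \<in> {0..R} \<Longrightarrow> A x > 0" and le1: "\<And>x. x \<in> {0..R} \<Longrightarrow> A x \<le> 1"
  obtains M where "L < M"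
    "\<And>B B1 B2 x. hyp_sol c M B B1 B2 \<Longrightarrow> x \<in> {0..R} \<Longrightarrow> B x > 0"
proof -
  obtain y where y: "y \<in> {0..R}" and min: "\<And>x. x \<in> {0..R} \<Longrightarrow> A y \<le> A x"
    using continuous_attains_inf[OF compact_Icc _ hyp_sol_continuous(1)[OF A order_refl, of R]] R by auto
  define \<delta> where "\<delta> = A y"
  have \<delta>: "0 < \<delta>" using pos[OF y] by (simp add: \<delta>_def)
  define C where "C = 2 * R / c * exp (2 * (L + 1) * R / c)"
  have C: "0 < C" using R c by (simp add: C_def)
  \<comment> \<open>The cap 1 keeps the exponent of the perturbation bound at most that in
    \<open>C\<close>; the other term limits the deviation to \<open>\<delta> / 2\<close>.\<close>
  define M where "M = L + min 1 (\<delta> / (2 * C))"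
  have M: "L < M" "M \<le> L + 1" "M - L \<le> \<delta> / (2 * C)" using \<delta> C by (auto simp: M_def)
  show ?thesis
  proof (rule that[OF M(1)])
    fix B B1 B2 x assume B: "hyp_sol c M B B1 B2" and x: "x \<in> {0..R}"
    have "\<bar>A x - B x\<bar> \<le> 2 * \<bar>M - L\<bar> * R / c * exp (2 * M * R / c)"
      by (rule hyp_sol_perturbation[OF A B c _ R _ x])
        (use M L pos le1 in \<open>auto simp: abs_of_pos\<close>)
    also have "\<dots> \<le> 2 * \<bar>M - L\<bar> * R / c * exp (2 * (L + 1) * R / c)"
      using M R c by (intro mult_left_mono) (auto simp: divide_right_mono)
    also have "\<dots> = (M - L) * C" using M by (simp add: C_def)
    also have "\<dots> \<le> \<delta> / (2 * C) * C" using M C by (intro mult_right_mono) auto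
    also have "\<dots> < \<delta>" using C \<delta> by simp
    also have "\<delta> \<le> A x" using min[OF x] by (simp add: \<delta>_def)
    finally show "B x > 0" by (simp add: abs_less_iff)
  qed
qed

section \<open>Existence of the first eigenvalue\<close>

text \<open>At the supremum, approximation from below gives \<open>A \<ge> 0\<close>, and stability
  of positivity forces a zero. A zero before \<open>R\<close> would be crossed with negative slope,
  so the first zero is \<open>R\<close>.\<close>

lemma exists_first_zero_eigenvalue:
  fixes c R :: real
  assumes c: "0 < c" and R: "0 < R"
    and ex: "\<And>L. 0 < L \<Longrightarrow> \<exists>A A1 A2. hyp_sol c L A A1 A2"
  obtains L A A1 A2 where "0 < L" "hyp_sol c L A A1 A2"
    "\<And>x. 0 \<le> x \<Longrightarrow> x < R \<Longrightarrow> A x > 0" "A R = 0"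
proof -
  define S where "S = {L. 0 < L \<and> (\<exists>A A1 A2. hyp_sol c L A A1 A2 \<and> (\<forall>x\<in>{0..R}. A x > 0))}"
  have up: "\<exists>M\<in>S. L < M"
    if A: "hyp_sol c L A A1 A2" and L: "0 \<le> L" and pos: "\<And>x. x \<in> {0..R} \<Longrightarrow> A x > 0"
      and le1: "\<And>x. x \<in> {0..R} \<Longrightarrow> A x \<le> 1" for L A A1 A2
  proof -
    obtain M where M: "L < M" "\<And>B B1 B2 x. hyp_sol c M B B1 B2 \<Longrightarrow> x \<in> {0..R} \<Longrightarrow> B x > 0"
      using hyp_sol_positive_open[OF A c L R pos le1] by blast
    have "0 < M" using L M by simp
    with ex[of M] M(2) have "M \<in> S" unfolding S_def by blast
    with M(1) show ?thesis by blast
  qed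
  \<comment> \<open>For parameter 0 the constant 1 is a positive solution, and stability of
    positivity then supplies an element of \<open>S\<close>.\<close>
  have "hyp_sol c 0 (\<lambda>_. 1) (\<lambda>_. 0) (\<lambda>_. 0)" by (simp add: hyp_sol_def)
  then have "S \<noteq> {}" using up[of 0 "\<lambda>_. 1"] by auto
  obtain K where "\<And>L A A1 A2. hyp_sol c L A A1 A2 \<Longrightarrow> 0 \<le> L \<Longrightarrow>
      (\<And>x. x \<in> {0..R} \<Longrightarrow> A x > 0) \<Longrightarrow> L \<le> K"
    using hyp_sol_positive_imp_bounded[OF c R] by blast
  then have "L \<le> K" if "L \<in> S" for L
    using that unfolding S_def by (smt (verit) mem_Collect_eq)
  then have bdd: "bdd_above S" by (rule bdd_aboveI)
  define L where "L = Sup S"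
  obtain L' where "L' \<in> S" using \<open>S \<noteq> {}\<close> by auto
  then have L: "0 < L" using cSup_upper[OF \<open>L' \<in> S\<close> bdd] by (auto simp: L_def S_def)
  obtain A A1 A2 where A: "hyp_sol c L A A1 A2" using ex[OF L] by blast
  have nonneg: "A x \<ge> 0" if x: "x \<in> {0..R}" for x
  proof (rule ccontr)
    assume neg: "\<not> A x \<ge> 0"
    define C where "C = 2 * R / c * exp (2 * L * R / c)"
    have C: "0 < C" using R c by (simp add: C_def)
    \<comment> \<open>Some \<open>M\<close> in \<open>S\<close> is so close to \<open>L\<close> that
      the deviation bound \<open>(L - M) * C\<close> is below \<open>- A x\<close>, which
      contradicts \<open>B x > 0\<close>.\<close>
    have "L - (- A x) / C < Sup S" using neg C by (simp add: L_def divide_neg_pos)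
    then obtain M where M: "M \<in> S" "L - (- A x) / C < M"
      using less_cSup_iff[OF \<open>S \<noteq> {}\<close> bdd] by blast
    then obtain B B1 B2 where B: "hyp_sol c M B B1 B2" and posB: "\<And>x. x \<in> {0..R} \<Longrightarrow> B x > 0"
      and M0: "0 < M" by (auto simp: S_def)
    have "M \<le> L" using cSup_upper[OF M(1) bdd] by (simp add: L_def)
    have B1: "\<bar>B y\<bar> \<le> 1" if y: "y \<in> {0..R}" for y
    proof (cases "y = 0")
      case False
      then have "B y < 1"
        using y by (intro hyp_sol_decreasing(2)[OF B c M0]) (auto intro: posB)
      then show ?thesis using posB[OF y] by simp
    qed (simp add: hyp_solD(1)[OF B])
    have "\<bar>B x - A x\<bar> \<le> 2 * \<bar>L - M\<bar> * R / c * exp (2 * L * R / c)"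
      by (rule hyp_sol_perturbation[OF B A c L R B1 x])
    also have "\<dots> = (L - M) * C" using \<open>M \<le> L\<close> by (simp add: C_def)
    also have "\<dots> < - A x" using M(2) C by (simp add: field_simps)
    finally show False using posB[OF x] by (simp add: abs_less_iff)
  qed
  have neg_after: "\<exists>y\<in>{0..R}. A y < 0"
    if s: "0 < s" "s < R" "A s = 0" and pos: "\<And>y. 0 \<le> y \<Longrightarrow> y < s \<Longrightarrow> A y > 0" for s
  proof -
    have "A1 s < 0" by (rule hyp_sol_decreasing(1)[OF A c L s(1) pos])
    then obtain d where d: "0 < d" "\<And>h. 0 < h \<Longrightarrow> h < d \<Longrightarrow> A (s + h) < A s"
      using DERIV_neg_dec_right[OF hyp_solD(2)[OF A less_imp_le[OF s(1)]]] by blast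
    define h where "h = min (d / 2) (R - s)"
    have "0 < h" "h < d" "s + h \<le> R" using d s by (auto simp: h_def)
    then show ?thesis using d(2)[of h] s by (intro bexI[of _ "s + h"]) auto
  qed
  have "\<not> (\<forall>x\<in>{0..R}. A x > 0)"
  proof
    assume pos: "\<forall>x\<in>{0..R}. A x > 0"
    have "A x \<le> 1" if x: "x \<in> {0..R}" for x
    proof (cases "x = 0")
      case False
      then have "A x < 1"
        using x by (intro hyp_sol_decreasing(2)[OF A c L]) (auto intro: pos[rule_format])
      then show ?thesis by simp
    qed (simp add: hyp_solD(1)[OF A])
    with up[OF A] L pos obtain M where "M \<in> S" "L < M" by auto
    then show False using cSup_upper[OF _ bdd, of M] by (simp add: L_def)
  qed
  then obtain x where x: "x \<in> {0..R}" "A x \<le> 0" by force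
  obtain s where s: "0 < s" "s \<le> R" "A s = 0" and pos: "\<And>y. 0 \<le> y \<Longrightarrow> y < s \<Longrightarrow> A y > 0"
    by (rule first_zero[OF hyp_sol_continuous(1)[OF A order_refl] _ x])
      (simp_all add: hyp_solD(1)[OF A])
  have "s = R"
  proof (rule ccontr)
    assume "s \<noteq> R"
    then have "s < R" using s by simp
    from neg_after[OF s(1) this s(3) pos] nonneg show False by force
  qed
  then show ?thesis using that[OF L A pos] s by simp
qed

text \<open>With \<open>c = 1 \<mp> \<beta>\<close> the two solutions carry the singular and the regular Legendre function, whose
  Wronskian is constant.\<close>

lemma hyp_sol_regular_pos:
  assumes A: "hyp_sol (1 - \<beta>) L A A1 A2" and B: "hyp_sol (1 + \<beta>) L B B1 B2"
    and \<beta>: "0 < \<beta>" and L: "0 < L" and r: "0 < r"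
    and pos: "\<And>x. 0 \<le> x \<Longrightarrow> x < r \<Longrightarrow> A x > 0" and x: "0 \<le> x" "x < r"
  shows "B x > 0"
proof (rule ccontr)
  assume "\<not> B x > 0"
  then have nonpos: "B x \<le> 0" and x': "x \<in> {0..x}" using x by auto
  obtain s where s: "0 < s" "s \<le> x" "B s = 0" and posB: "\<And>y. 0 \<le> y \<Longrightarrow> y < s \<Longrightarrow> B y > 0"
    by (rule first_zero[OF hyp_sol_continuous(1)[OF B order_refl] _ x' nonpos])
      (simp_all add: hyp_solD(1)[OF B])
  \<comment> \<open>This is half the Wronskian, for the derivation
    \<open>sinh \<theta> d/d\<theta>\<close>, of \<open>A\<close> times the coth power and
    \<open>B\<close> times the tanh power; the powers cancel. It equals \<open>\<beta>\<close> at 0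
    but would be negative at the first zero of \<open>B\<close>.\<close>
  let ?W = "\<lambda>x. \<beta> * (A x * B x) + x * (1 + x) * (B1 x * A x - A1 x * B x)"
  have "?W s = ?W 0"
  proof (rule DERIV_isconst2[OF s(1)])
    show "continuous_on {0..s} ?W"
      by (intro continuous_intros hyp_sol_continuous[OF A] hyp_sol_continuous[OF B]) simp_all
    show "DERIV ?W y :> 0" if y: "0 < y" "y < s" for y
    proof -
      have "(?W has_real_derivative \<beta> * (A1 y * B y + B1 y * A y)
          + ((1 + 2 * y) * (B1 y * A y - A1 y * B y)
             + ((B2 y * A y + A1 y * B1 y) - (A2 y * B y + B1 y * A1 y)) * (y * (1 + y)))) (at y)"
        by (intro DERIV_add DERIV_cmult DERIV_mult DERIV_diff hyp_solD[OF A] hyp_solD[OF B])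
          (use y in \<open>auto intro!: derivative_eq_intros\<close>)
      moreover have "y * (1 + y) * A2 y = - ((1 - \<beta>) + 2 * y) * A1 y - L * A y"
        "y * (1 + y) * B2 y = - ((1 + \<beta>) + 2 * y) * B1 y - L * B y"
        using hyp_solD(4)[OF A] hyp_solD(4)[OF B] y by simp_all
      then have "\<beta> * (A1 y * B y + B1 y * A y)
          + ((1 + 2 * y) * (B1 y * A y - A1 y * B y)
             + ((B2 y * A y + A1 y * B1 y) - (A2 y * B y + B1 y * A1 y)) * (y * (1 + y))) = 0"
        by algebra
      ultimately show ?thesis by simp
    qed
  qed (use s in auto)
  then have "s * (1 + s) * (B1 s * A s) = \<beta>"
    using s by (simp add: hyp_solD(1)[OF A] hyp_solD(1)[OF B])
  moreover have "B1 s < 0"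
    by (rule hyp_sol_decreasing(1)[OF B _ L s(1) posB]) (use \<beta> in simp)
  moreover have "0 < A s" using pos s x by simp
  then have "s * (1 + s) * (B1 s * A s) < 0"
    using s \<open>B1 s < 0\<close> by (intro mult_pos_neg mult_neg_pos mult_pos_pos) auto
  ultimately show False using \<beta> by simp
qed

section \<open>The Pohozaev argument\<close>

lemma no_positive_solution_if_singular_pos:
  fixes n \<theta>\<^sub>1 lam :: real
  assumes n: "2 < n" and \<theta>\<^sub>1: "0 < \<theta>\<^sub>1" and L: "0 < L" and lam: "lam = n * (n - 2) / 4 + L"
    and \<beta>: "\<beta> = (n - 2) / 2"
    and A: "hyp_sol (1 - \<beta>) L A A1 A2" and B: "hyp_sol (1 + \<beta>) L B B1 B2" and \<beta>1: "\<beta> < 1"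
    and pos: "\<And>x. 0 \<le> x \<Longrightarrow> x < (sinh (\<theta>\<^sub>1 / 2))\<^sup>2 \<Longrightarrow> A x > 0"
  shows "\<not> positive_solution n \<theta>\<^sub>1 lam u"
proof
  assume "positive_solution n \<theta>\<^sub>1 lam u"
  then obtain u' u'' where
      du: "\<And>\<theta>. \<theta> \<in> {0..\<theta>\<^sub>1} \<Longrightarrow> (u has_real_derivative u' \<theta>) (at \<theta> within {0..\<theta>\<^sub>1})"
    and cu': "continuous_on {0..\<theta>\<^sub>1} u'"
    and du': "\<And>\<theta>. \<theta> \<in> {0<..<\<theta>\<^sub>1} \<Longrightarrow> (u' has_real_derivative u'' \<theta>) (at \<theta>)"
    and eq: "\<And>\<theta>. \<theta> \<in> {0<..<\<theta>\<^sub>1} \<Longrightarrow> - u'' \<theta> - (n - 1) * (cosh \<theta> / sinh \<theta>) * u' \<theta> =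
             lam * u \<theta> + u \<theta> powr ((n + 2) / (n - 2))"
    and u1: "u \<theta>\<^sub>1 = 0" and upos: "\<And>\<theta>. \<theta> \<in> {0..<\<theta>\<^sub>1} \<Longrightarrow> u \<theta> > 0"
    unfolding positive_solution_def by blast
  have cu: "continuous_on {0..\<theta>\<^sub>1} u" using du by (rule DERIV_continuous_on)
  have \<beta>0: "0 < \<beta>" using n \<beta> by simp
  have n\<beta>: "n = 2 * \<beta> + 2" using \<beta> by simp
  define p where "p = (n + 2) / (n - 2)"
  \<comment> \<open>Criticality of the exponent: by \<open>\<beta> * p = \<beta> + 2\<close> the
    nonlinear term becomes \<open>y powr p\<close> without any weight.\<close>
  have p: "\<beta> * p = \<beta> + 2" "0 < p + 1" using n by (simp_all add: p_def \<beta> field_simps)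
  define X where "X \<theta> = (sinh (\<theta> / 2))\<^sup>2" for \<theta> :: real
  have sX: "(sinh \<theta>)\<^sup>2 = 4 * X \<theta> * (1 + X \<theta>)" for \<theta>
    using sinh_double[of "\<theta> / 2"] by (simp add: X_def power_mult_distrib cosh_square_eq)
  have dX: "(X has_real_derivative sinh \<theta> / 2) (at \<theta>)" for \<theta>
    using sinh_double[of "\<theta> / 2"] unfolding X_def
    by (auto intro!: derivative_eq_intros)
  have X0: "0 \<le> X \<theta>" for \<theta> by (simp add: X_def)
  have X_less: "X \<theta> < X \<theta>\<^sub>1" "0 < X \<theta>" if "0 < \<theta>" "\<theta> < \<theta>\<^sub>1" for \<theta>
    using that by (auto simp: X_def intro!: power_strict_mono)
  have X1: "0 < X \<theta>\<^sub>1" using \<theta>\<^sub>1 by (simp add: X_def)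
  note posA = pos[folded X_def]
  have posB: "B x > 0" if "0 \<le> x" "x < X \<theta>\<^sub>1" for x
    by (rule hyp_sol_regular_pos[OF A B \<beta>0 L X1 posA that])
  define a where "a \<theta> = A (X \<theta>)" for \<theta>
  define b where "b \<theta> = B (X \<theta>)" for \<theta>
  \<comment> \<open>\<open>ad\<close>, \<open>bd\<close>, \<open>z\<close> are the images of \<open>a\<close>, \<open>b\<close>, \<open>y\<close> under the derivation \<open>sinh \<theta> d/d\<theta>\<close>.\<close>
  define ad where "ad \<theta> = 2 * X \<theta> * (1 + X \<theta>) * A1 (X \<theta>)" for \<theta>
  define bd where "bd \<theta> = 2 * X \<theta> * (1 + X \<theta>) * B1 (X \<theta>)" for \<theta>
  define y where "y \<theta> = sinh \<theta> powr \<beta> * u \<theta>" for \<theta>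
  define z where "z \<theta> = sinh \<theta> powr \<beta> * (\<beta> * cosh \<theta> * u \<theta> + sinh \<theta> * u' \<theta>)" for \<theta>
  \<comment> \<open>The Wronskians of the overview with their tanh and coth powers removed. These
    powers are reciprocal, so the product is unchanged, while \<open>V2\<close> stays continuous at
    the centre.\<close>
  define V1 where "V1 \<theta> = b \<theta> * z \<theta> - (\<beta> * b \<theta> + bd \<theta>) * y \<theta>" for \<theta>
  define V2 where "V2 \<theta> = a \<theta> * z \<theta> - (ad \<theta> - \<beta> * a \<theta>) * y \<theta>" for \<theta>
  define E where "E \<theta> = V1 \<theta> * V2 \<theta> / 2 + a \<theta> * b \<theta> * y \<theta> powr (p + 1) / (p + 1)" for \<theta>
  \<comment> \<open>These four derivatives involve no division by \<open>sinh \<theta>\<close> and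
    hold at the centre too, which yields continuity of \<open>E\<close> on the closed
    interval.\<close>
  have da: "(a has_real_derivative A1 (X \<theta>) * (sinh \<theta> / 2)) (at \<theta>)" for \<theta>
    unfolding a_def by (rule DERIV_chain2[OF hyp_solD(2)[OF A X0] dX])
  have db: "(b has_real_derivative B1 (X \<theta>) * (sinh \<theta> / 2)) (at \<theta>)" for \<theta>
    unfolding b_def by (rule DERIV_chain2[OF hyp_solD(2)[OF B X0] dX])
  have dad: "(ad has_real_derivative sinh \<theta> * (\<beta> * A1 (X \<theta>) - L * a \<theta>)) (at \<theta>)" for \<theta>
  proof -
    have "(ad has_real_derivative 2 * (sinh \<theta> / 2) * (1 + X \<theta>) * A1 (X \<theta>)
        + 2 * X \<theta> * (sinh \<theta> / 2) * A1 (X \<theta>)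
        + 2 * X \<theta> * (1 + X \<theta>) * (A2 (X \<theta>) * (sinh \<theta> / 2))) (at \<theta>)"
      unfolding ad_def
      by (rule derivative_eq_intros dX DERIV_chain2[OF hyp_solD(3)[OF A X0] dX] refl
        | simp add: algebra_simps)+
    moreover have "2 * (sinh \<theta> / 2) * (1 + X \<theta>) * A1 (X \<theta>) + 2 * X \<theta> * (sinh \<theta> / 2) * A1 (X \<theta>)
        + 2 * X \<theta> * (1 + X \<theta>) * (A2 (X \<theta>) * (sinh \<theta> / 2)) = sinh \<theta> * (\<beta> * A1 (X \<theta>) - L * a \<theta>)"
      using hyp_solD(4)[OF A X0[of \<theta>]] unfolding a_def by algebra
    ultimately show ?thesis by simp
  qed
  have dbd: "(bd has_real_derivative sinh \<theta> * (- \<beta> * B1 (X \<theta>) - L * b \<theta>)) (at \<theta>)" for \<theta>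
  proof -
    have "(bd has_real_derivative 2 * (sinh \<theta> / 2) * (1 + X \<theta>) * B1 (X \<theta>)
        + 2 * X \<theta> * (sinh \<theta> / 2) * B1 (X \<theta>)
        + 2 * X \<theta> * (1 + X \<theta>) * (B2 (X \<theta>) * (sinh \<theta> / 2))) (at \<theta>)"
      unfolding bd_def
      by (rule derivative_eq_intros dX DERIV_chain2[OF hyp_solD(3)[OF B X0] dX] refl
        | simp add: algebra_simps)+
    moreover have "2 * (sinh \<theta> / 2) * (1 + X \<theta>) * B1 (X \<theta>) + 2 * X \<theta> * (sinh \<theta> / 2) * B1 (X \<theta>)
        + 2 * X \<theta> * (1 + X \<theta>) * (B2 (X \<theta>) * (sinh \<theta> / 2)) = sinh \<theta> * (- \<beta> * B1 (X \<theta>) - L * b \<theta>)"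
      using hyp_solD(4)[OF B X0[of \<theta>]] unfolding b_def by algebra
    ultimately show ?thesis by simp
  qed
  have cont: "continuous_on {0..\<theta>\<^sub>1} E"
  proof -
    have "continuous_on {0..\<theta>\<^sub>1} f" if "\<And>\<theta>. (f has_real_derivative f' \<theta>) (at \<theta>)" for f f'
      by (rule DERIV_continuous_on, rule has_field_derivative_at_within, rule that)
    note cab = this[OF da] this[OF db] this[OF dad] this[OF dbd]
    have cs: "continuous_on {0..\<theta>\<^sub>1} (\<lambda>\<theta>. sinh \<theta> powr \<beta>)"
      using \<beta>0 by (intro continuous_on_powr' continuous_intros) auto
    have cy: "continuous_on {0..\<theta>\<^sub>1} y" and cz: "continuous_on {0..\<theta>\<^sub>1} z"
      unfolding y_def z_def by (intro continuous_intros cs cu cu')+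
    have ynn: "0 \<le> y \<theta>" if "\<theta> \<in> {0..\<theta>\<^sub>1}" for \<theta>
      using upos[of \<theta>] u1 that by (cases "\<theta> = \<theta>\<^sub>1") (auto simp: y_def)
    have "continuous_on {0..\<theta>\<^sub>1} (\<lambda>\<theta>. y \<theta> powr (p + 1))"
      using p(2) ynn by (intro continuous_on_powr' continuous_intros cy) auto
    then show ?thesis
      unfolding E_def V1_def V2_def using p(2)
      by (intro continuous_on_add continuous_on_diff continuous_on_mult continuous_on_divide
          continuous_on_const cab cy cz) auto
  qed
  have "E \<theta>\<^sub>1 < E 0"
  proof (rule DERIV_neg_imp_decreasing_open[OF \<theta>\<^sub>1 _ cont])
    fix \<theta> assume \<theta>: "0 < \<theta>" "\<theta> < \<theta>\<^sub>1"
    define s C where "s = sinh \<theta>" and "C = cosh \<theta>"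
    have s: "0 < s" using \<theta> by (simp add: s_def)
    have Cs: "C\<^sup>2 = 1 + s\<^sup>2" by (simp add: C_def s_def cosh_square_eq)
    have u: "0 < u \<theta>" using upos \<theta> by simp
    have y0: "0 < y \<theta>" using u s by (simp add: y_def s_def)
    have dsp: "((\<lambda>\<theta>. sinh \<theta> powr \<beta>) has_real_derivative \<beta> * (s powr \<beta> / s) * C) (at \<theta>)"
      using s by (auto intro!: derivative_eq_intros simp: s_def C_def powr_diff)
    have du1: "(u has_real_derivative u' \<theta>) (at \<theta>)"
      using du[of \<theta>] \<theta> at_within_Icc_at[of 0 \<theta> \<theta>\<^sub>1] by simp
    have dy: "(y has_real_derivative z \<theta> / s) (at \<theta>)"
      unfolding y_def z_def
      by (rule DERIV_cong[OF DERIV_mult[OF dsp du1]])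
        (use s in \<open>simp add: s_def[symmetric] C_def[symmetric] field_simps\<close>)
    define up where "up = u \<theta> powr p"
    have eq': "s * u'' \<theta> = - (n - 1) * C * u' \<theta> - s * (lam * u \<theta> + up)"
      using eq[of \<theta>] \<theta> s
      by (simp add: p_def[symmetric] up_def[symmetric] s_def[symmetric] C_def[symmetric] field_simps)
    define S where "S = s powr \<beta>"
    have yp: "y \<theta> powr p = S * s\<^sup>2 * up"
    proof -
      have "y \<theta> powr p = s powr (\<beta> * p) * up"
        using u s by (simp add: y_def powr_mult powr_powr up_def s_def)
      also have "s powr (\<beta> * p) = S * s\<^sup>2"
        using s by (simp add: p powr_add S_def)
      finally show ?thesis .
    qed
    define zd where "zd = - (L * s\<^sup>2 - \<beta>\<^sup>2) * y \<theta> - y \<theta> powr p"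
    have dz: "(z has_real_derivative zd / s) (at \<theta>)"
    proof -
      have "((\<lambda>\<theta>. \<beta> * cosh \<theta> * u \<theta> + sinh \<theta> * u' \<theta>) has_real_derivative
          \<beta> * s * u \<theta> + \<beta> * C * u' \<theta> + (C * u' \<theta> + s * u'' \<theta>)) (at \<theta>)"
        using \<theta> by (auto intro!: derivative_eq_intros du1 du' simp: s_def C_def)
      from DERIV_mult[OF dsp this]
      have "(z has_real_derivative \<beta> * (S / s) * C * (\<beta> * C * u \<theta> + s * u' \<theta>)
          + (\<beta> * s * u \<theta> + \<beta> * C * u' \<theta> + (C * u' \<theta> + s * u'' \<theta>)) * S) (at \<theta>)"
        unfolding z_def S_def s_def C_def .
      moreover have "\<beta> * (S / s) * C * (\<beta> * C * u \<theta> + s * u' \<theta>)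
          + (\<beta> * s * u \<theta> + \<beta> * C * u' \<theta> + (C * u' \<theta> + s * u'' \<theta>)) * S = zd / s"
      proof -
        \<comment> \<open>With the reciprocal as a variable, the claim follows by polynomial algebra
          from \<open>Cs\<close> and \<open>eq'\<close>. The part
          \<open>\<beta> * (\<beta> + 1)\<close> of \<open>lam\<close> is absorbed by the weight in
          \<open>y\<close>.\<close>
        define i where "i = 1 / s"
        have i: "s * i = 1" using s by (simp add: i_def)
        have lam': "lam = \<beta> * (\<beta> + 1) + L" using lam by (simp add: n\<beta> field_simps)
        have zd: "zd = - (L * s\<^sup>2 - \<beta>\<^sup>2) * (S * u \<theta>) - S * s\<^sup>2 * up"
          unfolding zd_def yp by (simp add: y_def S_def s_def)
        have "\<beta> * (S * i) * C * (\<beta> * C * u \<theta> + s * u' \<theta>)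
          + (\<beta> * s * u \<theta> + \<beta> * C * u' \<theta> + (C * u' \<theta> + s * u'' \<theta>)) * S = zd * i"
          using i Cs eq' unfolding zd lam' n\<beta> by algebra
        then show ?thesis by (simp add: i_def)
      qed
      ultimately show ?thesis by simp
    qed
    have X': "0 < X \<theta>" "X \<theta> < X \<theta>\<^sub>1" using X_less \<theta> by auto
    have ab: "0 < a \<theta>" "0 < b \<theta>" using posA posB X' by (simp_all add: a_def b_def)
    have "A1 (X \<theta>) < 0"
      by (rule hyp_sol_decreasing(1)[OF A _ L X'(1)]) (use posA X' \<beta>1 in auto)
    then have adneg: "ad \<theta> < 0" using X' by (simp add: ad_def mult_pos_neg)
    have "B1 (X \<theta>) < 0"
      by (rule hyp_sol_decreasing(1)[OF B _ L X'(1)]) (use posB X' \<beta>0 in auto)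
    then have bdneg: "bd \<theta> < 0" using X' by (simp add: bd_def mult_pos_neg)
    \<comment> \<open>By \<open>sX\<close>, the derivatives \<open>A1\<close> and \<open>B1\<close>
      can be eliminated in favour of \<open>ad\<close> and \<open>bd\<close>.\<close>
    have sad: "A1 (X \<theta>) * s\<^sup>2 = 2 * ad \<theta>" "B1 (X \<theta>) * s\<^sup>2 = 2 * bd \<theta>"
      by (simp_all add: s_def sX ad_def bd_def)
    define i where "i = 1 / s"
    have i: "s * i = 1" using s by (simp add: i_def)
    have da': "(a has_real_derivative ad \<theta> * i) (at \<theta>)"
      by (rule DERIV_cong[OF da]) (use sad(1) i in \<open>fold s_def, algebra\<close>)
    have db': "(b has_real_derivative bd \<theta> * i) (at \<theta>)"
      by (rule DERIV_cong[OF db]) (use sad(2) i in \<open>fold s_def, algebra\<close>)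
    have dad': "(ad has_real_derivative (2 * \<beta> * ad \<theta> - L * s\<^sup>2 * a \<theta>) * i) (at \<theta>)"
      by (rule DERIV_cong[OF dad]) (use sad(1) i in \<open>fold s_def, algebra\<close>)
    have dbd': "(bd has_real_derivative (- 2 * \<beta> * bd \<theta> - L * s\<^sup>2 * b \<theta>) * i) (at \<theta>)"
      by (rule DERIV_cong[OF dbd]) (use sad(2) i in \<open>fold s_def, algebra\<close>)
    have dy': "(y has_real_derivative z \<theta> * i) (at \<theta>)"
      and dz': "(z has_real_derivative zd * i) (at \<theta>)"
      using dy dz by (simp_all add: i_def)
    define Y where "Y = y \<theta> powr p"
    have zd': "zd = - (L * s\<^sup>2 - \<beta>\<^sup>2) * y \<theta> - Y" by (simp add: zd_def Y_def)
    \<comment> \<open>The terms with factor \<open>\<beta>\<close> here and in \<open>dV2\<close>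
      stem from the removed powers and cancel in the derivative of \<open>V1 * V2\<close>.\<close>
    have dV1: "(V1 has_real_derivative (- \<beta> * V1 \<theta> - b \<theta> * Y) * i) (at \<theta>)"
      unfolding V1_def
      by (rule DERIV_cong[OF DERIV_diff[OF DERIV_mult[OF db' dz']
            DERIV_mult[OF DERIV_add[OF DERIV_cmult[OF db'] dbd'] dy']]])
        (use zd' in algebra)
    have dV2: "(V2 has_real_derivative (\<beta> * V2 \<theta> - a \<theta> * Y) * i) (at \<theta>)"
      unfolding V2_def
      by (rule DERIV_cong[OF DERIV_diff[OF DERIV_mult[OF da' dz']
            DERIV_mult[OF DERIV_diff[OF dad' DERIV_cmult[OF da']] dy']]])
        (use zd' in algebra)
    have Yy: "y \<theta> powr (p + 1) = Y * y \<theta>" using y0 by (simp add: Y_def powr_add)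
    have dyp: "((\<lambda>\<theta>. y \<theta> powr (p + 1)) has_real_derivative (p + 1) * Y * (z \<theta> * i)) (at \<theta>)"
      using y0 by (auto intro!: derivative_eq_intros dy' simp: Y_def)
    have "(E has_real_derivative
        ((- \<beta> * V1 \<theta> - b \<theta> * Y) * i * V2 \<theta> + (\<beta> * V2 \<theta> - a \<theta> * Y) * i * V1 \<theta>) / 2
        + ((ad \<theta> * i * b \<theta> + bd \<theta> * i * a \<theta>) * (y \<theta> powr (p + 1))
           + (p + 1) * Y * (z \<theta> * i) * (a \<theta> * b \<theta>)) / (p + 1)) (at \<theta>)"
      unfolding E_def
      by (intro DERIV_add DERIV_cdivide DERIV_mult dV1 dV2 dyp da' db')
    \<comment> \<open>In \<open>b * V2 + a * V1\<close> the \<open>\<beta>\<close> terms cancel,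
      leaving \<open>2 * a * b * z - (ad * b + bd * a) * y\<close>. The \<open>z\<close> part
      cancels against the derivative of the power of \<open>y\<close>, and only the derivative of
      \<open>a * b\<close> remains.\<close>
    moreover have "((- \<beta> * V1 \<theta> - b \<theta> * Y) * i * V2 \<theta> + (\<beta> * V2 \<theta> - a \<theta> * Y) * i * V1 \<theta>) / 2
        + ((ad \<theta> * i * b \<theta> + bd \<theta> * i * a \<theta>) * (y \<theta> powr (p + 1))
           + (p + 1) * Y * (z \<theta> * i) * (a \<theta> * b \<theta>)) / (p + 1)
        = (1 / 2 + 1 / (p + 1)) * (Y * y \<theta> * i * (ad \<theta> * b \<theta> + bd \<theta> * a \<theta>))"
    proof -
      define q where "q = 1 / (p + 1)"
      have q: "(p + 1) * q = 1" using p(2) by (simp add: q_def)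
      have "((- \<beta> * V1 \<theta> - b \<theta> * Y) * i * V2 \<theta> + (\<beta> * V2 \<theta> - a \<theta> * Y) * i * V1 \<theta>) * (1 / 2)
        + ((ad \<theta> * i * b \<theta> + bd \<theta> * i * a \<theta>) * (Y * y \<theta>)
           + (p + 1) * Y * (z \<theta> * i) * (a \<theta> * b \<theta>)) * q
        = (1 / 2 + q) * (Y * y \<theta> * i * (ad \<theta> * b \<theta> + bd \<theta> * a \<theta>))"
        using q unfolding V1_def V2_def by algebra
      then show ?thesis by (simp add: q_def Yy)
    qed
    moreover have "\<dots> < 0"
    proof -
      have "ad \<theta> * b \<theta> + bd \<theta> * a \<theta> < 0"
        using adneg bdneg ab by (intro add_neg_neg mult_neg_pos)
      moreover have "0 < Y * y \<theta> * i" using y0 s by (simp add: Y_def i_def)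
      moreover have "0 < 1 / 2 + 1 / (p + 1)" using p(2) by (simp add: add_pos_pos)
      ultimately show ?thesis by (intro mult_pos_neg)
    qed
    ultimately show "\<exists>D. (E has_real_derivative D) (at \<theta>) \<and> D < 0" by (auto intro!: exI)
  qed
  \<comment> \<open>\<open>sinh 0 powr \<beta>\<close> is 0, so \<open>y\<close>, \<open>z\<close>
    and hence \<open>V1\<close> vanish at the centre.\<close>
  moreover have "E 0 = 0" by (simp add: E_def V1_def y_def z_def)
  \<comment> \<open>The boundary condition gives \<open>y = 0\<close>, which leaves half the product
    of \<open>b * z\<close> and \<open>a * z\<close>.\<close>
  moreover have "0 \<le> E \<theta>\<^sub>1"
  proof -
    have "0 \<le> a \<theta>\<^sub>1" unfolding a_def
      by (rule nonneg_at_right_endpoint[OF hyp_sol_continuous(1)[OF A order_refl] X1 posA])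
    moreover have "0 \<le> b \<theta>\<^sub>1" unfolding b_def
      by (rule nonneg_at_right_endpoint[OF hyp_sol_continuous(1)[OF B order_refl] X1 posB])
    moreover have "E \<theta>\<^sub>1 = (a \<theta>\<^sub>1 * b \<theta>\<^sub>1) * (z \<theta>\<^sub>1)\<^sup>2 / 2"
      by (simp add: E_def V1_def V2_def y_def u1 power2_eq_square)
    ultimately show ?thesis by (metis divide_nonneg_pos mult_nonneg_nonneg zero_le_power2 zero_less_numeral)
  qed
  ultimately show False by simp
qed

section \<open>Legendre functions and the critical parameter\<close>

text \<open>This is the perturbation estimate with error 0. The interval runs to
  \<open>x + 1\<close> so that its length is positive even for \<open>x = 0\<close>.\<close>

lemma hyp_sol_unique:
  assumes A: "hyp_sol c L A A1 A2" and B: "hyp_sol c L B B1 B2"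
    and c: "0 < c" and L: "0 < L" and x: "0 \<le> x"
  shows "A x = B x"
proof -
  have "\<bar>A x - B x\<bar> \<le> 2 * 0 * (x + 1) / c * exp (2 * L * (x + 1) / c)"
  proof (rule hypergeo_ode_perturbation[where d = "\<lambda>x. A x - B x"])
    show "A 0 - B 0 = 0" using hyp_solD(1)[OF A] hyp_solD(1)[OF B] by simp
    fix t assume t: "t \<in> {0..x + 1}"
    then show "((\<lambda>x. A x - B x) has_real_derivative A1 t - B1 t) (at t)"
      and "((\<lambda>x. A1 x - B1 x) has_real_derivative A2 t - B2 t) (at t)"
      by (auto intro!: DERIV_diff hyp_solD[OF A] hyp_solD[OF B])
    have "t * (1 + t) * A2 t = - (c + 2 * t) * A1 t - L * A t"
      "t * (1 + t) * B2 t = - (c + 2 * t) * B1 t - L * B t"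
      using hyp_solD(4)[OF A] hyp_solD(4)[OF B] t by simp_all
    then have "t * (1 + t) * (A2 t - B2 t) + (c + 2 * t) * (A1 t - B1 t) + L * (A t - B t) = 0"
      by algebra
    then show "\<bar>t * (1 + t) * (A2 t - B2 t) + (c + 2 * t) * (A1 t - B1 t) + L * (A t - B t)\<bar> \<le> 0"
      by simp
  qed (use c L x in auto)
  then show ?thesis by simp
qed

text \<open>The equation has real coefficients even for complex \<open>l\<close>. The imaginary part
  along the half-line therefore solves it with initial value 0, and vanishes by the perturbation
  estimate with error 0.\<close>

lemma hyp2F1_hyp_sol:
  fixes c L :: real and l :: complex
  assumes c: "0 < c" and L: "0 < L" and l: "of_real L = - (l * (l + 1))"
  defines "h \<equiv> hyp2F1 (- l) (l + 1) (of_real c)"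
  obtains A A1 A2 where "hyp_sol c L A A1 A2"
    "\<And>x. 0 \<le> x \<Longrightarrow> h (of_real (- x)) = of_real (A x)"
proof -
  define H where "H = {z :: complex. Re z < 1 / 2}"
  have "of_real c + of_nat k \<noteq> (0 :: complex)" for k
  proof -
    have "of_real c + of_nat k = (of_real (c + real k) :: complex)" by simp
    moreover have "c + real k \<noteq> 0" using c by simp
    ultimately show ?thesis by (metis of_real_eq_0_iff)
  qed
  note hyp = hyp2F1_half_plane[where a = "- l" and b = "l + 1" and c = "of_real c", OF this, folded h_def H_def]
  have "open H" unfolding H_def by (rule open_halfspace_Re_lt)
  have zH: "of_real (- x) \<in> H" if "0 \<le> x" for x using that by (simp add: H_def)
  have dh: "(h has_field_derivative deriv h z) (at z)"
    and dh1: "(deriv h has_field_derivative deriv (deriv h) z) (at z)" if "z \<in> H" for z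
    by (rule holomorphic_derivI[OF _ \<open>open H\<close> that], intro hyp(1) holomorphic_deriv \<open>open H\<close>)+
  have chain: "((\<lambda>x. Re (f (of_real (- x)))) has_real_derivative - Re f') (at x)"
    "((\<lambda>x. Im (f (of_real (- x)))) has_real_derivative - Im f') (at x)"
    if "(f has_field_derivative f') (at (of_real (- x)))" for f :: "complex \<Rightarrow> complex" and f' x
  proof -
    have "((\<lambda>z. f (- z)) has_field_derivative f' * - 1) (at (of_real x))"
      using that by (intro DERIV_chain2[of f _ "\<lambda>z. - z"]) (auto intro!: derivative_eq_intros)
    then have "((\<lambda>x. f (of_real (- x))) has_vector_derivative - f') (at x)"
      by (auto dest: has_vector_derivative_real_field)
    then show "((\<lambda>x. Re (f (of_real (- x)))) has_real_derivative - Re f') (at x)"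
      "((\<lambda>x. Im (f (of_real (- x)))) has_real_derivative - Im f') (at x)"
      unfolding has_real_derivative_iff_has_vector_derivative
      by (auto dest: bounded_linear.has_vector_derivative[OF bounded_linear_Re]
          bounded_linear.has_vector_derivative[OF bounded_linear_Im])
  qed
  \<comment> \<open>The sign in \<open>A1\<close>, and likewise in \<open>D1\<close>, comes from the
    reflection of \<open>x\<close> to \<open>- x\<close>.\<close>
  define A A1 A2 where "A x = Re (h (of_real (- x)))"
    and "A1 x = - Re (deriv h (of_real (- x)))"
    and "A2 x = Re (deriv (deriv h) (of_real (- x)))" for x
  define D D1 D2 where "D x = Im (h (of_real (- x)))"
    and "D1 x = - Im (deriv h (of_real (- x)))"
    and "D2 x = Im (deriv (deriv h) (of_real (- x)))" for x
  have dA: "(A has_real_derivative A1 x) (at x)" and dD: "(D has_real_derivative D1 x) (at x)"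
    if "0 \<le> x" for x
    unfolding A_def[abs_def] A1_def D_def[abs_def] D1_def
    by (rule chain[OF dh[OF zH[OF that]]])+
  have dA1: "(A1 has_real_derivative A2 x) (at x)" and dD1: "(D1 has_real_derivative D2 x) (at x)"
    if "0 \<le> x" for x
    unfolding A1_def[abs_def] A2_def D1_def[abs_def] D2_def
    using chain[OF dh1[OF zH[OF that]], THEN DERIV_minus] by (simp_all only: minus_minus)
  have ode: "of_real (x * (1 + x)) * deriv (deriv h) (of_real (- x))
      - of_real (c + 2 * x) * deriv h (of_real (- x)) + of_real L * h (of_real (- x)) = 0"
    if "0 \<le> x" for x
  proof -
    \<comment> \<open>The parameters satisfy \<open>a + b + 1 = 2\<close> and
      \<open>a * b = L\<close>, so \<open>l\<close> enters only through \<open>L\<close>.\<close>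
    let ?z = "of_real (- x) :: complex"
    have "?z * (1 - ?z) * deriv (deriv h) ?z + (of_real c - (- l + (l + 1) + 1) * ?z) * deriv h ?z
        - - l * (l + 1) * h ?z = 0"
      by (rule hyp(3)[OF zH[OF that]])
    moreover have "of_real (x * (1 + x)) = - (?z * (1 - ?z))" "of_real (c + 2 * x) = of_real c - 2 * ?z"
      by simp_all
    ultimately show ?thesis using l by algebra
  qed
  have odeA: "x * (1 + x) * A2 x + (c + 2 * x) * A1 x + L * A x = 0"
    and odeD: "x * (1 + x) * D2 x + (c + 2 * x) * D1 x + L * D x = 0" if "0 \<le> x" for x
  proof -
    have [simp]: "Re (of_real r * w) = r * Re w" "Im (of_real r * w) = r * Im w" for r and w :: complex
      by simp_all
    show "x * (1 + x) * A2 x + (c + 2 * x) * A1 x + L * A x = 0"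
      using arg_cong[OF ode[OF that], of Re] unfolding A_def A1_def A2_def
      by (simp del: of_real_mult of_real_add of_real_minus)
    show "x * (1 + x) * D2 x + (c + 2 * x) * D1 x + L * D x = 0"
      using arg_cong[OF ode[OF that], of Im] unfolding D_def D1_def D2_def
      by (simp del: of_real_mult of_real_add of_real_minus)
  qed
  have "D x = 0" if x: "0 \<le> x" for x
  proof -
    have "\<bar>D x\<bar> \<le> 2 * 0 * (x + 1) / c * exp (2 * L * (x + 1) / c)"
      by (rule hypergeo_ode_perturbation[where d = D and ?d1.0 = D1 and ?d2.0 = D2])
        (use c L x dD dD1 odeD in \<open>auto simp: D_def hyp(2)\<close>)
    then show ?thesis by simp
  qed
  moreover have "hyp_sol c L A A1 A2"
    unfolding hyp_sol_def using dA dA1 odeA by (auto simp: A_def hyp(2))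
  ultimately show ?thesis
    by (intro that[of A A1 A2]) (auto simp: A_def D_def complex_eq_iff)
qed

lemma exists_legendre_degree: "\<exists>l :: complex. of_real L = - (l * (l + 1))"
proof
  let ?s = "csqrt (1 - 4 * of_real L)"
  have "?s * ?s = 1 - 4 * of_real L" by (metis power2_csqrt power2_eq_square)
  then show "of_real L = - ((?s - 1) / 2 * ((?s - 1) / 2 + 1))" by (simp add: field_simps)
qed

lemma exists_hyp_sol:
  assumes "0 < c" "0 < L"
  obtains A A1 A2 where "hyp_sol c L A A1 A2"
  using exists_legendre_degree[of L] hyp2F1_hyp_sol[OF assms] by blast

text \<open>The prefactor \<open>k\<close> is positive because \<open>\<beta> < 1\<close> makes
  \<open>Gamma (1 - \<beta>)\<close> positive. Thus the sign and the zeros of the Legendre function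
  are those of \<open>A\<close>.\<close>

lemma legendreP_hyp_sol:
  fixes \<beta> L :: real
  assumes \<beta>: "\<beta> < 1" and L: "0 < L" and l: "of_real L = - (l * (l + 1))"
    and A: "hyp_sol (1 - \<beta>) L A A1 A2"
  obtains k where "\<And>\<theta>. 0 < \<theta> \<Longrightarrow> 0 < k \<theta>"
    "\<And>\<theta>. 0 < \<theta> \<Longrightarrow> legendreP \<beta> l \<theta> = of_real (k \<theta> * A ((sinh (\<theta> / 2))\<^sup>2))"
proof -
  have c: "0 < 1 - \<beta>" using \<beta> by simp
  obtain B B1 B2 where B: "hyp_sol (1 - \<beta>) L B B1 B2"
    "\<And>x. 0 \<le> x \<Longrightarrow> hyp2F1 (- l) (l + 1) (of_real (1 - \<beta>)) (of_real (- x)) = of_real (B x)"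
    using hyp2F1_hyp_sol[OF c L l] by blast
  define k where "k \<theta> = 1 / Gamma (1 - \<beta>) * (cosh (\<theta>/2) / sinh (\<theta>/2)) powr \<beta>" for \<theta> :: real
  show ?thesis
  proof
    fix \<theta> :: real assume \<theta>: "0 < \<theta>"
    then show "0 < k \<theta>" using c by (simp add: k_def Gamma_real_pos)
    have "B ((sinh (\<theta> / 2))\<^sup>2) = A ((sinh (\<theta> / 2))\<^sup>2)"
      by (rule hyp_sol_unique[OF B(1) A c L]) simp
    then show "legendreP \<beta> l \<theta> = of_real (k \<theta> * A ((sinh (\<theta> / 2))\<^sup>2))"
      unfolding legendreP_def B(2)[OF zero_le_power2] by (simp add: k_def)
  qed
qed

text \<open>\<open>L\<close> is admissible since the Legendre function is a positive multiple of
  \<open>A\<close>. For a smaller admissible \<open>M\<close>, Sturm comparison would make its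
  solution positive at \<open>R\<close>, where it must vanish.\<close>

lemma Lstar_eqI:
  fixes n \<theta>\<^sub>1 :: real
  defines "\<beta> \<equiv> (n - 2) / 2" and "R \<equiv> (sinh (\<theta>\<^sub>1 / 2))\<^sup>2"
  assumes n: "n < 4" and \<theta>\<^sub>1: "0 < \<theta>\<^sub>1" and L: "0 < L" and A: "hyp_sol (1 - \<beta>) L A A1 A2"
    and pos: "\<And>x. 0 \<le> x \<Longrightarrow> x < R \<Longrightarrow> A x > 0" and zero: "A R = 0"
  shows "Lstar n \<theta>\<^sub>1 = L"
proof -
  have \<beta>: "\<beta> < 1" and c: "0 < 1 - \<beta>" using n by (simp_all add: \<beta>_def)
  have R: "0 < R" using \<theta>\<^sub>1 by (simp add: R_def)
  have \<alpha>: "- ((2 - n) / 2) = \<beta>" by (simp add: \<beta>_def field_simps)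
  show ?thesis
    unfolding Lstar_def Let_def \<alpha>
  proof (rule Least_equality)
    obtain l where l: "complex_of_real L = - (l * (l + 1))" using exists_legendre_degree by blast
    obtain k where k: "\<And>\<theta>. 0 < \<theta> \<Longrightarrow> 0 < k \<theta>"
      "\<And>\<theta>. 0 < \<theta> \<Longrightarrow> legendreP \<beta> l \<theta> = of_real (k \<theta> * A ((sinh (\<theta> / 2))\<^sup>2))"
      using legendreP_hyp_sol[OF \<beta> L l A] by blast
    have "0 < Re (legendreP \<beta> l \<theta>)" if "0 < \<theta>" "\<theta> < \<theta>\<^sub>1" for \<theta>
      using that k(1) by (auto simp: k(2) R_def intro!: mult_pos_pos pos power_strict_mono)
    moreover have "legendreP \<beta> l \<theta>\<^sub>1 = 0" using zero \<theta>\<^sub>1 by (simp add: k(2) R_def)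
    ultimately show "0 < L \<and> (\<exists>l. complex_of_real L = - (l * (l + 1)) \<and>
        (\<forall>\<theta>. 0 < \<theta> \<and> \<theta> < \<theta>\<^sub>1 \<longrightarrow> 0 < Re (legendreP \<beta> l \<theta>)) \<and> legendreP \<beta> l \<theta>\<^sub>1 = 0)"
      using L l by blast
  next
    fix M assume "0 < M \<and> (\<exists>l. complex_of_real M = - (l * (l + 1)) \<and>
        (\<forall>\<theta>. 0 < \<theta> \<and> \<theta> < \<theta>\<^sub>1 \<longrightarrow> 0 < Re (legendreP \<beta> l \<theta>)) \<and> legendreP \<beta> l \<theta>\<^sub>1 = 0)"
    then obtain l where M: "0 < M" and l: "complex_of_real M = - (l * (l + 1))"
      and zeroM: "legendreP \<beta> l \<theta>\<^sub>1 = 0" by blast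
    obtain B B1 B2 where B: "hyp_sol (1 - \<beta>) M B B1 B2" using exists_hyp_sol[OF c M] by blast
    obtain k where k: "\<And>\<theta>. 0 < \<theta> \<Longrightarrow> 0 < k \<theta>"
      "\<And>\<theta>. 0 < \<theta> \<Longrightarrow> legendreP \<beta> l \<theta> = of_real (k \<theta> * B ((sinh (\<theta> / 2))\<^sup>2))"
      using legendreP_hyp_sol[OF \<beta> M l B] by blast
    have "B R = 0" using zeroM k(1)[OF \<theta>\<^sub>1] \<theta>\<^sub>1 by (simp add: k(2) R_def)
    then show "L \<le> M"
      using hyp_sol_sturm[OF B A c M _ R pos, of R] R by (cases "L \<le> M") auto
  qed
qed

theorem theorem4p1:
  fixes n \<theta>\<^sub>1 lam :: real
  assumes "2 < n" and "n < 4" and "0 < \<theta>\<^sub>1"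
    and "lam \<in> {n * (n - 2) / 4 <.. n * (n - 2) / 4 + Lstar n \<theta>\<^sub>1}"
  shows "\<not> (\<exists>u. positive_solution n \<theta>\<^sub>1 lam u)"
proof -
  define \<beta> where "\<beta> = (n - 2) / 2"
  define R where "R = (sinh (\<theta>\<^sub>1 / 2))\<^sup>2"
  define L where "L = lam - n * (n - 2) / 4"
  have \<beta>: "0 < \<beta>" "\<beta> < 1" and c: "0 < 1 - \<beta>" "0 < 1 + \<beta>"
    using assms by (simp_all add: \<beta>_def field_simps)
  have R: "0 < R" using assms by (simp add: R_def)
  have L: "0 < L" "L \<le> Lstar n \<theta>\<^sub>1" using assms by (simp_all add: L_def)
  obtain M C C1 C2 where M: "0 < M" "hyp_sol (1 - \<beta>) M C C1 C2" "C R = 0"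
    and posC: "\<And>x. 0 \<le> x \<Longrightarrow> x < R \<Longrightarrow> C x > 0"
    using exists_first_zero_eigenvalue[OF c(1) R] exists_hyp_sol[OF c(1)] by metis
  have "Lstar n \<theta>\<^sub>1 = M"
    by (rule Lstar_eqI[of n \<theta>\<^sub>1, folded \<beta>_def R_def, OF assms(2,3) M(1,2) posC M(3)])
  then have "L \<le> M" using L by simp
  obtain A A1 A2 where A: "hyp_sol (1 - \<beta>) L A A1 A2" using exists_hyp_sol[OF c(1) L(1)] by blast
  obtain B B1 B2 where B: "hyp_sol (1 + \<beta>) L B B1 B2" using exists_hyp_sol[OF c(2) L(1)] by blast
  \<comment> \<open>At the closed end \<open>L = M\<close> of the range, \<open>A\<close> agrees
    with \<open>C\<close> by uniqueness; below it, Sturm comparison with \<open>C\<close>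
    applies.\<close>
  have posA: "A x > 0" if "0 \<le> x" "x < R" for x
  proof (cases "L = M")
    case True
    then show ?thesis
      using hyp_sol_unique[OF A _ c(1) L(1) that(1)] M(2) posC[OF that] by simp
  next
    case False
    then show ?thesis
      using hyp_sol_sturm[OF A M(2) c(1) L(1) _ R posC] \<open>L \<le> M\<close> that by simp
  qed
  have "lam = n * (n - 2) / 4 + L" by (simp add: L_def)
  then show ?thesis
    using no_positive_solution_if_singular_pos[OF assms(1,3) L(1) _ \<beta>_def A B \<beta>(2) posA[unfolded R_def]]
    by blast
qed

end
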